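(* Consider rotational $(-\alpha)$-homogeneous solutions $(u,p,\rho)$ of the stationary inviscid Boussinesq equations having the $x_2$-symmetry. Then: (i) For $0\le\alpha\le 1$, no such solutions $(u,p,\rho)\in C^1(\mathbb{R}^2\setminus\{0\})$ exist. (ii) For $-1/2\le\alpha<0$, no such solutions $(u,p,\rho)\in C^2(\mathbb{R}^2\setminus\{0\})$ exist. (iii) For every $\alpha>1$, such solutions $(u,p,\rho)\in C^2(\mathbb{R}^2\setminus\{0\})$ exist. (iv) For every $\alpha<-2$, such solutions $(u,p,\rho)\in C^1(\mathbb{R}^2)$ exist.
   Context: The stationary two-dimensional inviscid Boussinesq equations for $u=(u^1,u^2)$, $p$, $\rho$ are $$u\cdot\nabla u+\nabla p=-\rho e_2,\qquad \nabla\cdot u=0,\qquad u\cdot\nabla\rho=0,\qquad e_2=(0,1).$$ For functions in $C^k(\mathbb{R}^2\setminus\{0\})$ the equations are required in $\mathbb{R}^2\setminus\{0\}$; for functions in $C^1(\mathbb{R}^2)$ they are required in $\mathbb{R}^2$. For $\alpha\in\mathbb{R}$, $(u,p,\rho)$ is called $(-\alpha)$-homogeneous if $u(x)=|x|^{-\alpha}u(x/|x|)$, $p(x)=|x|^{-2\alpha}p(x/|x|)$, $\rho(x)=|x|^{-2\alpha-1}\rho(x/|x|)$ for $x\ne0$. The $x_2$-symmetry is: $u^1(x_1,x_2)=u^1(x_1,-x_2)$, $u^2(x_1,x_2)=-u^2(x_1,-x_2)$, $p(x_1,x_2)=p(x_1,-x_2)$, $\rho(x_1,x_2)=-\rho(x_1,-x_2)$.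 A solution is rotational if its vorticity $\omega=\nabla^\perp\cdot u=\partial_1u^2-\partial_2u^1$ is not identically zero, where $\nabla^\perp=(-\partial_2,\partial_1)$. *)

theory Defs
  imports "HOL-Analysis.Analysis"
begin

text \<open>
  Scalar and vector fields are total functions on \<^typ>\<open>real^2\<close>; everything below only refers
  to their restriction to an open set \<open>D\<close>, which is either the punctured plane or the
  whole plane.
\<close>

abbreviation punctured_plane :: "(real^2) set" where
  "punctured_plane \<equiv> UNIV - {0}"

definition partial_derivative ::
  "2 \<Rightarrow> (real^2 \<Rightarrow> 'b::real_normed_vector) \<Rightarrow> real^2 \<Rightarrow> 'b" where
  "partial_derivative i f x = frechet_derivative f (at x) (axis i 1)"

text \<open>
  The class $C^k(D)$ for open \<open>D\<close>. Requiring (total) differentiability at each step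
  loses nothing, since continuous first partial derivatives on an open set imply it; it ensures
  that \<^const>\<open>partial_derivative\<close> denotes the actual partial derivative.
\<close>

fun C_k_on :: "nat \<Rightarrow> (real^2) set \<Rightarrow> (real^2 \<Rightarrow> 'b::real_normed_vector) \<Rightarrow> bool" where
  "C_k_on 0 D f \<longleftrightarrow> continuous_on D f"
| "C_k_on (Suc k) D f \<longleftrightarrow>
     (\<forall>x\<in>D. f differentiable (at x)) \<and> (\<forall>i. C_k_on k D (partial_derivative i f))"

definition grad :: "(real^2 \<Rightarrow> real) \<Rightarrow> real^2 \<Rightarrow> real^2" where
  "grad f x = (\<chi> i. partial_derivative i f x)"

definition divergence :: "(real^2 \<Rightarrow> real^2) \<Rightarrow> real^2 \<Rightarrow> real" where
  "divergence u x = (\<Sum>i\<in>UNIV. partial_derivative i u x $ i)"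

definition vorticity :: "(real^2 \<Rightarrow> real^2) \<Rightarrow> real^2 \<Rightarrow> real" where
  "vorticity u x = partial_derivative 1 u x $ 2 - partial_derivative 2 u x $ 1"

definition advection ::
  "(real^2 \<Rightarrow> real^2) \<Rightarrow> (real^2 \<Rightarrow> 'b::real_normed_vector) \<Rightarrow> real^2 \<Rightarrow> 'b" where
  "advection u f x = (\<Sum>j\<in>UNIV. (u x $ j) *\<^sub>R partial_derivative j f x)"

definition stationary_boussinesq ::
  "(real^2) set \<Rightarrow> (real^2 \<Rightarrow> real^2) \<Rightarrow> (real^2 \<Rightarrow> real) \<Rightarrow> (real^2 \<Rightarrow> real) \<Rightarrow> bool" where
  "stationary_boussinesq D u p \<rho> \<longleftrightarrow>
     (\<forall>x\<in>D. advection u u x + grad p x = - (\<rho> x *\<^sub>R axis 2 1)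
          \<and> divergence u x = 0
          \<and> advection u \<rho> x = 0)"

definition neg_homogeneous ::
  "real \<Rightarrow> (real^2 \<Rightarrow> real^2) \<Rightarrow> (real^2 \<Rightarrow> real) \<Rightarrow> (real^2 \<Rightarrow> real) \<Rightarrow> bool" where
  "neg_homogeneous \<alpha> u p \<rho> \<longleftrightarrow>
     (\<forall>x. x \<noteq> 0 \<longrightarrow>
          u x = (norm x powr (-\<alpha>)) *\<^sub>R u (x /\<^sub>R norm x)
        \<and> p x = norm x powr (-2 * \<alpha>) * p (x /\<^sub>R norm x)
        \<and> \<rho> x = norm x powr (-2 * \<alpha> - 1) * \<rho> (x /\<^sub>R norm x))"

definition x2_symmetric ::
  "(real^2) set \<Rightarrow> (real^2 \<Rightarrow> real^2) \<Rightarrow> (real^2 \<Rightarrow> real) \<Rightarrow> (real^2 \<Rightarrow> real) \<Rightarrow> bool" where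
  "x2_symmetric D u p \<rho> \<longleftrightarrow>
     (\<forall>x1 x2. vector [x1, x2] \<in> D \<longrightarrow>
          u (vector [x1, x2]) $ 1 = u (vector [x1, - x2]) $ 1
        \<and> u (vector [x1, x2]) $ 2 = - u (vector [x1, - x2]) $ 2
        \<and> p (vector [x1, x2]) = p (vector [x1, - x2])
        \<and> \<rho> (vector [x1, x2]) = - \<rho> (vector [x1, - x2]))"

definition rotational :: "(real^2) set \<Rightarrow> (real^2 \<Rightarrow> real^2) \<Rightarrow> bool" where
  "rotational D u \<longleftrightarrow> (\<exists>x\<in>D. vorticity u x \<noteq> 0)"

definition rotational_homogeneous_symmetric_solution ::
  "nat \<Rightarrow> (real^2) set \<Rightarrow> real \<Rightarrow>
   (real^2 \<Rightarrow> real^2) \<Rightarrow> (real^2 \<Rightarrow> real) \<Rightarrow> (real^2 \<Rightarrow> real) \<Rightarrow> bool" where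
  "rotational_homogeneous_symmetric_solution k D \<alpha> u p \<rho> \<longleftrightarrow>
     C_k_on k D u \<and> C_k_on k D p \<and> C_k_on k D \<rho>
   \<and> stationary_boussinesq D u p \<rho>
   \<and> neg_homogeneous \<alpha> u p \<rho>
   \<and> x2_symmetric D u p \<rho>
   \<and> rotational D u"

end

theory Submission
  imports Defs
begin

text \<open>
  In polar coordinates a homogeneous solution is given by functions \<open>a\<close> (radial velocity), \<open>b\<close>
  (angular velocity), \<open>P\<close>, \<open>R\<close> of the angle with \<open>b' = (\<alpha> - 1) * a\<close>, and the symmetry gives
  \<open>b 0 = R 0 = 0\<close>. The density obeys \<open>b * R' = (2 * \<alpha> + 1) * a * R\<close>, so \<open>R * \<bar>b\<bar> powr \<gamma>\<close> with
  \<open>\<gamma> = (2 * \<alpha> + 1) / (1 - \<alpha>)\<close> is constant between zeros of \<open>b\<close>; for \<open>\<gamma> > 0\<close> continuity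
  at a zero forces \<open>R = 0\<close> wherever \<open>b\<close> does not vanish. There the flow is a homogeneous Euler flow, whose
  vorticity is transported in the same way and vanishes by the same argument. For
  \<open>\<alpha> = - 1 / 2\<close> and \<open>\<alpha> = 1\<close> these exponents degenerate, and the equations give \<open>R' = 0\<close> and \<open>b = 0\<close>
  respectively.

  For \<open>\<alpha> < - 2\<close> the shear flow \<open>(\<bar>x\<^sub>2\<bar> powr (- \<alpha>), 0)\<close> is a solution. For \<open>\<alpha> > 1\<close> there is
  an Euler solution (\<open>\<rho> = 0\<close>) whose stream function is \<open>r powr (1 - \<alpha>) * f \<theta>\<close> with \<open>f\<close> an odd periodic
  solution of a nonlinear oscillator equation; the period is matched to \<open>2 * pi\<close> by the intermediate value
  theorem in the amplitude.
\<close>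

subsection \<open>Homogeneous fields in polar coordinates\<close>

definition circ :: "real \<Rightarrow> real^2" where
  "circ t = vector [cos t, sin t]"

lemma circ_nth [simp]: "circ t $ 1 = cos t" "circ t $ 2 = sin t"
  by (simp_all add: circ_def)

lemma norm_vec2: "norm (x :: real^2) = sqrt ((x $ 1)\<^sup>2 + (x $ 2)\<^sup>2)"
  by (simp add: norm_vec_def L2_set_def sum_2)

lemma norm_circ [simp]: "norm (circ t) = 1"
  by (simp add: norm_vec2)

lemma circ_nonzero [simp]: "circ t \<noteq> 0"
  using norm_circ[of t] by fastforce

lemma vec2_eq_iff: "(x :: 'a^2) = y \<longleftrightarrow> x $ 1 = y $ 1 \<and> x $ 2 = y $ 2"
  by (simp add: vec_eq_iff forall_2)

text \<open>Oriented as rewrite rules eliminating squares of \<open>sin\<close>; the second form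
  catches the right-nested products left by \<open>algebra_simps\<close>, so that trigonometric
  identities reduce to normalisation.\<close>

lemma sin_mult_sin:
  fixes t z :: real
  shows "sin t * sin t = 1 - cos t * cos t" "sin t * (sin t * z) = z - cos t * (cos t * z)"
proof -
  show *: "sin t * sin t = 1 - cos t * cos t"
    using sin_squared_eq[of t] by (simp add: power2_eq_square)
  have "sin t * (sin t * z) = (sin t * sin t) * z" by simp
  also have "\<dots> = z - cos t * (cos t * z)" unfolding * by (simp add: algebra_simps)
  finally show "sin t * (sin t * z) = z - cos t * (cos t * z)" .
qed

lemma polar_decomposition: "\<exists>t. norm x *\<^sub>R circ t = x"
proof (cases "x = 0")
  case False
  have "(x $ 1 / norm x)\<^sup>2 + (x $ 2 / norm x)\<^sup>2 = ((x $ 1)\<^sup>2 + (x $ 2)\<^sup>2) / (norm x)\<^sup>2"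
    by (simp add: power_divide add_divide_distrib)
  also have "\<dots> = 1"
    using False by (simp add: norm_vec2 vec2_eq_iff sum_power2_eq_zero_iff)
  finally obtain t where t: "x $ 1 / norm x = cos t" "x $ 2 / norm x = sin t"
    using sincos_total_2pi by metis
  have "norm x *\<^sub>R circ t = x"
    using False by (simp add: vec2_eq_iff flip: t)
  then show ?thesis ..
qed simp

text \<open>Makes a function of the angle well defined on the unit circle, so an arbitrary choice of
  angle is harmless.\<close>

lemma circ_eq_imp_eq:
  assumes "circ s = circ t" and per: "\<And>t. g (t + 2 * pi) = g t"
  shows "g s = g t"
proof -
  have *: "g (t + 2 * pi * real n) = g t" for n t
  proof (induction n)
    case (Suc n)
    have "g (t + 2 * pi * real (Suc n)) = g ((t + 2 * pi * real n) + 2 * pi)"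
      by (simp add: algebra_simps)
    then show ?case using per Suc by simp
  qed simp
  have "sin s = sin t \<and> cos s = cos t"
    using assms(1) by (metis circ_nth)
  then obtain n :: int where n: "s = t + 2 * pi * n"
    using sin_cos_eq_iff by blast
  show ?thesis
  proof (cases "n \<ge> 0")
    case True
    then show ?thesis using *[of t "nat n"] n by simp
  next
    case False
    then show ?thesis using *[of s "nat (- n)"] n by simp
  qed
qed

text \<open>The profile \<open>g\<close> lives on the whole line, so that one-variable calculus
  applies to it; its periodicity is implied, and the value of \<open>h\<close> at the origin is left
  free.\<close>

definition polar_form :: "(real^2 \<Rightarrow> 'b::real_normed_vector) \<Rightarrow> real \<Rightarrow> (real \<Rightarrow> 'b) \<Rightarrow> bool" where
  "polar_form h s g \<longleftrightarrow> (\<forall>r>0. \<forall>t. h (r *\<^sub>R circ t) = r powr s *\<^sub>R g t)"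

lemma polar_formD: "polar_form h s g \<Longrightarrow> r > 0 \<Longrightarrow> h (r *\<^sub>R circ t) = r powr s *\<^sub>R g t"
  by (simp add: polar_form_def)

lemma polar_form_exists:
  fixes g :: "real \<Rightarrow> 'b::real_normed_vector"
  assumes "\<And>t. g (t + 2 * pi) = g t"
  shows "\<exists>h. polar_form h s g"
proof -
  define ang where "ang x = (SOME t. norm x *\<^sub>R circ t = x)" for x
  have "norm x *\<^sub>R circ (ang x) = x" for x
    unfolding ang_def by (rule someI_ex) (rule polar_decomposition)
  then have "circ (ang (r *\<^sub>R circ t)) = circ t" if "r > 0" for r t
  proof -
    have "norm (r *\<^sub>R circ t) = r" using that by simp
    then have "r *\<^sub>R circ t = r *\<^sub>R circ (ang (r *\<^sub>R circ t))"
      using \<open>\<And>x. norm x *\<^sub>R circ (ang x) = x\<close> by metis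
    then show ?thesis using that by (metis order_less_irrefl scaleR_cancel_left)
  qed
  then have "g (ang (r *\<^sub>R circ t)) = g t" if "r > 0" for r t
    using that assms circ_eq_imp_eq[of _ _ g] by blast
  then have "polar_form (\<lambda>x. norm x powr s *\<^sub>R g (ang x)) s g"
    by (simp add: polar_form_def)
  then show ?thesis by blast
qed

text \<open>Rotating the angular variable by \<open>t\<close> puts the ray through \<open>circ t\<close> on the positive
  axis, where \<^const>\<open>arctan\<close> is a branch of the angle.\<close>

lemma polar_chart:
  fixes y :: "real^2"
  assumes "y \<bullet> circ t > 0"
  shows "y = norm y *\<^sub>R circ (t + arctan ((y \<bullet> circ (t + pi / 2)) / (y \<bullet> circ t)))"
proof -
  \<comment> \<open>These are the coordinates of \<open>y\<close> in the orthonormal frame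
    \<open>circ t\<close>, \<open>circ (t + pi / 2)\<close>.\<close>
  define p q where "p = y \<bullet> circ t" and "q = y \<bullet> circ (t + pi / 2)"
  have p: "p = y $ 1 * cos t + y $ 2 * sin t" and q: "q = y $ 2 * cos t - y $ 1 * sin t"
    by (simp_all add: p_def q_def inner_vec_def sum_2 cos_add sin_add)
  have p0: "p > 0" using assms p_def by simp
  have "p\<^sup>2 + q\<^sup>2 = (y $ 1)\<^sup>2 + (y $ 2)\<^sup>2"
    unfolding p q by (simp add: power2_eq_square algebra_simps sin_mult_sin)
  then have n: "norm y = sqrt (p\<^sup>2 + q\<^sup>2)" by (simp add: norm_vec2)
  have s: "sqrt (1 + (q / p)\<^sup>2) = norm y / p"
  proof -
    have "1 + (q / p)\<^sup>2 = (p\<^sup>2 + q\<^sup>2) / p\<^sup>2" using p0 by (simp add: field_simps)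
    then show ?thesis using p0 n by (simp add: real_sqrt_divide)
  qed
  have "norm y > 0" using p0 n by (simp add: add_pos_nonneg)
  then have c: "norm y * cos (arctan (q / p)) = p" and d: "norm y * sin (arctan (q / p)) = q"
    using p0 by (simp_all add: cos_arctan sin_arctan s)
  have "norm y * cos (t + arctan (q / p)) = y $ 1"
  proof -
    have "norm y * cos (t + arctan (q / p)) =
        cos t * (norm y * cos (arctan (q / p))) - sin t * (norm y * sin (arctan (q / p)))"
      by (simp add: cos_add right_diff_distrib mult.left_commute)
    also have "\<dots> = cos t * p - sin t * q" by (simp only: c d)
    also have "\<dots> = y $ 1" unfolding p q by (simp add: algebra_simps sin_mult_sin)
    finally show ?thesis .
  qed
  moreover have "norm y * sin (t + arctan (q / p)) = y $ 2"
  proof -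
    have "norm y * sin (t + arctan (q / p)) =
        sin t * (norm y * cos (arctan (q / p))) + cos t * (norm y * sin (arctan (q / p)))"
      by (simp add: sin_add distrib_left mult.left_commute)
    also have "\<dots> = sin t * p + cos t * q" by (simp only: c d)
    also have "\<dots> = y $ 2" unfolding p q by (simp add: algebra_simps sin_mult_sin)
    finally show ?thesis .
  qed
  ultimately show ?thesis by (simp add: vec2_eq_iff p_def q_def)
qed

text \<open>Gives an explicit formula for \<open>h\<close> on an open half-plane around the ray
  through \<open>circ t\<close>; continuity and differentiability of \<open>h\<close> on that ray
  are read off from it.\<close>

lemma polar_form_local:
  assumes "polar_form h s g" "y \<bullet> circ t > 0"
  shows "h y = norm y powr s *\<^sub>R g (t + arctan ((y \<bullet> circ (t + pi / 2)) / (y \<bullet> circ t)))"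
proof -
  have "y \<noteq> 0" using assms(2) by auto
  then show ?thesis
    using polar_formD[OF assms(1), of "norm y"] polar_chart[OF assms(2)] by (metis zero_less_norm_iff)
qed

lemma inner_circ [simp]: "circ s \<bullet> circ t = cos (s - t)"
  by (simp add: inner_vec_def sum_2 cos_diff)

lemma open_half_plane_circ: "open {y :: real^2. y \<bullet> circ t > 0}"
  by (intro open_Collect_less continuous_intros)

section \<open>Regularity and derivatives of homogeneous functions\<close>

lemma polar_form_isCont:
  assumes h: "polar_form h s g" and g: "isCont g t" and r: "r > 0"
  shows "isCont h (r *\<^sub>R circ t)"
proof -
  have "((\<lambda>y. norm y powr s *\<^sub>R g (t + arctan ((y \<bullet> circ (t + pi / 2)) / (y \<bullet> circ t))))
      \<longlongrightarrow> norm (r *\<^sub>R circ t) powr s *\<^sub>R g t) (at (r *\<^sub>R circ t))"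
  proof (intro tendsto_scaleR isCont_tendsto_compose[OF g])
    show "((\<lambda>y. norm y powr s) \<longlongrightarrow> norm (r *\<^sub>R circ t) powr s) (at (r *\<^sub>R circ t))"
      using r by (intro tendsto_intros) auto
    have "((\<lambda>y. t + arctan ((y \<bullet> circ (t + pi / 2)) / (y \<bullet> circ t))) \<longlongrightarrow>
      t + arctan (((r *\<^sub>R circ t) \<bullet> circ (t + pi / 2)) / ((r *\<^sub>R circ t) \<bullet> circ t))) (at (r *\<^sub>R circ t))"
      using r by (intro tendsto_intros) auto
    then show "((\<lambda>y. t + arctan ((y \<bullet> circ (t + pi / 2)) / (y \<bullet> circ t))) \<longlongrightarrow> t) (at (r *\<^sub>R circ t))"
      by simp
  qed
  moreover have "\<forall>\<^sub>F y in at (r *\<^sub>R circ t). norm y powr s *\<^sub>R g (t + arctan ((y \<bullet> circ (t + pi / 2)) / (y \<bullet> circ t))) = h y"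
    unfolding eventually_at_topological
    by (rule exI[of _ "{y. y \<bullet> circ t > 0}"]) (use r open_half_plane_circ polar_form_local[OF h] in auto)
  ultimately have "(h \<longlongrightarrow> norm (r *\<^sub>R circ t) powr s *\<^sub>R g t) (at (r *\<^sub>R circ t))"
    by (rule Lim_transform_eventually)
  then show ?thesis using r polar_formD[OF h r] by (simp add: isCont_def)
qed

lemma polar_form_continuous_on:
  assumes "polar_form h s g" "continuous_on UNIV g"
  shows "continuous_on punctured_plane h"
proof -
  have "isCont h x" if "x \<noteq> 0" for x
  proof -
    obtain t where t: "norm x *\<^sub>R circ t = x" using polar_decomposition by blast
    have "isCont g t" using assms(2) by (simp add: continuous_on_eq_continuous_at)
    from polar_form_isCont[OF assms(1) this, of "norm x"] show ?thesis using that t by simp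
  qed
  then show ?thesis by (simp add: continuous_at_imp_continuous_on)
qed

text \<open>The two inner products are the radial and angular components of the increment
  \<open>v\<close>: the power of the radius is differentiated along the first, the profile along the
  second.\<close>

lemma polar_form_has_derivative:
  fixes g :: "real \<Rightarrow> 'b::real_normed_vector"
  assumes h: "polar_form h s g" and g: "(g has_vector_derivative g') (at t)" and r: "r > 0"
  shows "(h has_derivative (\<lambda>v. r powr (s - 1) *\<^sub>R
           ((s * (v \<bullet> circ t)) *\<^sub>R g t + (v \<bullet> circ (t + pi / 2)) *\<^sub>R g'))) (at (r *\<^sub>R circ t))"
proof -
  define \<tau> where "\<tau> y = t + arctan ((y \<bullet> circ (t + pi / 2)) / (y \<bullet> circ t))" for y :: "real^2"
  have \<tau>0: "\<tau> (r *\<^sub>R circ t) = t" by (simp add: \<tau>_def)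
  have d\<tau>: "(\<tau> has_derivative (\<lambda>v. (v \<bullet> circ (t + pi / 2)) / r)) (at (r *\<^sub>R circ t))"
    unfolding \<tau>_def
    using r by (auto intro!: derivative_eq_intros simp: fun_eq_iff field_simps)
  have dn: "((\<lambda>y. norm y powr s) has_derivative (\<lambda>v. r powr (s - 1) * s * (v \<bullet> circ t))) (at (r *\<^sub>R circ t))"
  proof -
    have "(norm has_derivative (\<lambda>v. v \<bullet> circ t)) (at (r *\<^sub>R circ t))"
      using has_derivative_norm[of "r *\<^sub>R circ t"] r by (simp add: sgn_div_norm inner_commute)
    from has_derivative_powr[OF this has_derivative_const[of s]]
    have "((\<lambda>y. norm y powr s) has_derivative (\<lambda>v. r powr s * (v \<bullet> circ t * s / r))) (at (r *\<^sub>R circ t))"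
      using r by simp
    moreover have "r powr s = r powr (s - 1) * r" using r by (simp add: powr_diff)
    ultimately show ?thesis using r by (simp add: mult.commute mult.left_commute)
  qed
  have dg: "((\<lambda>y. g (\<tau> y)) has_derivative (\<lambda>v. ((v \<bullet> circ (t + pi / 2)) / r) *\<^sub>R g')) (at (r *\<^sub>R circ t))"
    using has_derivative_compose[OF d\<tau>, of g "\<lambda>x. x *\<^sub>R g'"] g \<tau>0 by (simp add: has_vector_derivative_def)
  have rs: "r powr s / r = r powr (s - 1)" using r by (simp add: powr_diff)
  have "((\<lambda>y. norm y powr s *\<^sub>R g (\<tau> y)) has_derivative (\<lambda>v. r powr (s - 1) *\<^sub>R
           ((s * (v \<bullet> circ t)) *\<^sub>R g t + (v \<bullet> circ (t + pi / 2)) *\<^sub>R g'))) (at (r *\<^sub>R circ t))"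
  proof (rule has_derivative_eq_rhs[OF has_derivative_scaleR[OF dn dg]])
    have "r powr s * (z / r) = r powr (s - 1) * z" for z
      using rs by (metis times_divide_eq_left times_divide_eq_right)
    then show "(\<lambda>v. norm (r *\<^sub>R circ t) powr s *\<^sub>R (v \<bullet> circ (t + pi / 2) / r) *\<^sub>R g' +
          (r powr (s - 1) * s * (v \<bullet> circ t)) *\<^sub>R g (\<tau> (r *\<^sub>R circ t))) =
      (\<lambda>v. r powr (s - 1) *\<^sub>R ((s * (v \<bullet> circ t)) *\<^sub>R g t + (v \<bullet> circ (t + pi / 2)) *\<^sub>R g'))"
      using r by (simp add: \<tau>0 fun_eq_iff scaleR_add_right mult.assoc)
  qed
  then show ?thesis
    by (rule has_derivative_transform_within_open[OF _ open_half_plane_circ[of t]])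
      (use r polar_form_local[OF h] in \<open>simp_all add: \<tau>_def\<close>)
qed

text \<open>The angular profile of the \<open>i\<close>-th Cartesian partial derivative: the
  increment in the preceding lemma is taken to be the \<open>i\<close>-th unit vector.\<close>

definition angular_partial :: "2 \<Rightarrow> real \<Rightarrow> (real \<Rightarrow> 'b) \<Rightarrow> (real \<Rightarrow> 'b) \<Rightarrow> real \<Rightarrow> 'b::real_normed_vector" where
  "angular_partial i s g g' t =
     (s * circ t $ i) *\<^sub>R g t + circ (t + pi / 2) $ i *\<^sub>R g' t"

lemma angular_partial_1: "angular_partial 1 s g g' t = (s * cos t) *\<^sub>R g t - sin t *\<^sub>R g' t"
  by (simp add: angular_partial_def cos_add)

lemma angular_partial_2: "angular_partial 2 s g g' t = (s * sin t) *\<^sub>R g t + cos t *\<^sub>R g' t"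
  by (simp add: angular_partial_def sin_add)

text \<open>Differentiation stays within \<open>polar_form\<close> and lowers the degree by one, so
  it can be iterated for second derivatives.\<close>

lemma polar_form_partial_derivative:
  assumes "polar_form h s g" "\<And>t. (g has_vector_derivative g' t) (at t)"
  shows "polar_form (partial_derivative i h) (s - 1) (angular_partial i s g g')"
  unfolding polar_form_def
proof (intro allI impI)
  fix r t :: real assume r: "r > 0"
  show "partial_derivative i h (r *\<^sub>R circ t) = r powr (s - 1) *\<^sub>R angular_partial i s g g' t"
  proof -
    note d = polar_form_has_derivative[OF assms(1) assms(2)[of t] r]
    have ax: "axis i 1 \<bullet> x = x $ i" for x :: "real^2" by (simp add: inner_axis')
    show ?thesis
      unfolding partial_derivative_def angular_partial_def
      by (subst frechet_derivative_at[OF d, symmetric]) (simp only: ax)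
  qed
qed

lemma polar_form_differentiable:
  assumes "polar_form h s g" "\<And>t. (g has_vector_derivative g' t) (at t)" "x \<noteq> 0"
  shows "h differentiable (at x)"
proof -
  obtain t where t: "norm x *\<^sub>R circ t = x" using polar_decomposition by blast
  have "h differentiable (at (norm x *\<^sub>R circ t))"
    using polar_form_has_derivative[OF assms(1) assms(2)[of t], of "norm x"] assms(3)
    unfolding differentiable_def by (metis zero_less_norm_iff)
  then show ?thesis using t by simp
qed

lemma polar_form_C1:
  assumes "polar_form h s g" "\<And>t. (g has_vector_derivative g' t) (at t)" "continuous_on UNIV g'"
  shows "C_k_on 1 punctured_plane h"
proof -
  have "continuous_on UNIV g"
    by (meson assms(2) continuous_at_imp_continuous_on has_vector_derivative_continuous)
  then have "continuous_on UNIV (angular_partial i s g g')" for i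
    using assms(3) exhaust_2[of i]
    by (auto simp: angular_partial_1[abs_def] angular_partial_2[abs_def] intro!: continuous_intros)
  from polar_form_continuous_on[OF polar_form_partial_derivative[OF assms(1,2)] this]
  have "continuous_on punctured_plane (partial_derivative i h)" for i .
  then show ?thesis
    using polar_form_differentiable[OF assms(1,2)] by simp
qed

lemma polar_form_C2:
  fixes g :: "real \<Rightarrow> 'b::real_normed_vector"
  assumes "polar_form h s g" "\<And>t. (g has_vector_derivative g' t) (at t)"
    "\<And>t. (g' has_vector_derivative g'' t) (at t)" "continuous_on UNIV g''"
  shows "C_k_on 2 punctured_plane h"
proof -
  have cont: "continuous_on UNIV g" "continuous_on UNIV g'"
    by (meson assms(2,3) continuous_at_imp_continuous_on has_vector_derivative_continuous)+
  have "C_k_on 1 punctured_plane (partial_derivative i h)" for i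
  proof -
    have "i = 1 \<or> i = 2" by (rule exhaust_2)
    then show ?thesis
    proof
      assume i: "i = 1"
      have "(angular_partial 1 s g g' has_vector_derivative
          (s * cos t) *\<^sub>R g' t - (s * sin t) *\<^sub>R g t - (sin t *\<^sub>R g'' t + cos t *\<^sub>R g' t)) (at t)" for t
        unfolding angular_partial_1[abs_def]
        by (auto intro!: derivative_eq_intros assms(2,3)
            simp: has_real_derivative_iff_has_vector_derivative[symmetric])
      then show ?thesis unfolding i
        by (rule polar_form_C1[OF polar_form_partial_derivative[OF assms(1,2)]])
          (auto intro!: continuous_intros cont assms(4))
    next
      assume i: "i = 2"
      have "(angular_partial 2 s g g' has_vector_derivative
          (s * sin t) *\<^sub>R g' t + (s * cos t) *\<^sub>R g t + (cos t *\<^sub>R g'' t - sin t *\<^sub>R g' t)) (at t)" for t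
        unfolding angular_partial_2[abs_def]
        by (auto intro!: derivative_eq_intros assms(2,3)
            simp: has_real_derivative_iff_has_vector_derivative[symmetric])
      then show ?thesis unfolding i
        by (rule polar_form_C1[OF polar_form_partial_derivative[OF assms(1,2)]])
          (auto intro!: continuous_intros cont assms(4))
    qed
  qed
  then show ?thesis
    using polar_form_differentiable[OF assms(1,2)] by (simp add: numeral_2_eq_2)
qed

section \<open>The Boussinesq equations as a system in the angle\<close>

text \<open>All terms of one equation carry the same power of the radius. Cancelling it leaves
  equations in the angle alone, with \<open>a\<close> and \<open>b\<close> the radial and angular
  velocity profiles.\<close>

lemma polar_form_boussinesq:
  assumes u: "polar_form u (- \<alpha>) U" and p: "polar_form p (- 2 * \<alpha>) P"
    and \<rho>: "polar_form \<rho> (- 2 * \<alpha> - 1) R"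
    and U: "\<And>t. (U has_vector_derivative U' t) (at t)"
    and P: "\<And>t. (P has_real_derivative P' t) (at t)"
    and R: "\<And>t. (R has_real_derivative R' t) (at t)"
  defines "a \<equiv> \<lambda>t. U t $ 1 * cos t + U t $ 2 * sin t"
    and "b \<equiv> \<lambda>t. U t $ 2 * cos t - U t $ 1 * sin t"
  shows "stationary_boussinesq punctured_plane u p \<rho> \<longleftrightarrow>
    (\<forall>t. b t * U' t $ 1 - \<alpha> * a t * U t $ 1 - 2 * \<alpha> * P t * cos t - P' t * sin t = 0
       \<and> b t * U' t $ 2 - \<alpha> * a t * U t $ 2 - 2 * \<alpha> * P t * sin t + P' t * cos t = - R t
       \<and> U' t $ 2 * cos t - U' t $ 1 * sin t = \<alpha> * a t
       \<and> b t * R' t = (2 * \<alpha> + 1) * a t * R t)" (is "_ \<longleftrightarrow> (\<forall>t. ?E t)")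
proof -
  have du: "polar_form (partial_derivative i u) (- \<alpha> - 1) (angular_partial i (- \<alpha>) U U')" for i
    using u U by (rule polar_form_partial_derivative)
  have dp: "polar_form (partial_derivative i p) (- 2 * \<alpha> - 1) (angular_partial i (- 2 * \<alpha>) P P')" for i
    using p P by (intro polar_form_partial_derivative) (auto simp: has_real_derivative_iff_has_vector_derivative)
  have d\<rho>: "polar_form (partial_derivative i \<rho>) (- 2 * \<alpha> - 1 - 1) (angular_partial i (- 2 * \<alpha> - 1) R R')" for i
    using \<rho> R by (intro polar_form_partial_derivative) (auto simp: has_real_derivative_iff_has_vector_derivative)
  have E: "advection u u (r *\<^sub>R circ t) + grad p (r *\<^sub>R circ t) = - (\<rho> (r *\<^sub>R circ t) *\<^sub>R axis 2 1)
      \<and> divergence u (r *\<^sub>R circ t) = 0 \<and> advection u \<rho> (r *\<^sub>R circ t) = 0 \<longleftrightarrow> ?E t" (is "?L \<longleftrightarrow> _")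
    if r: "r > 0" for r t
  proof -
    \<comment> \<open>The common powers of the momentum equation (\<open>A1\<close>), of the
      divergence (\<open>A2\<close>) and of the density transport (\<open>A3\<close>).\<close>
    define A1 where "A1 = r powr (- 2 * \<alpha> - 1)"
    define A2 where "A2 = r powr (- \<alpha> - 1)"
    define A3 where "A3 = r powr (- 3 * \<alpha> - 2)"
    have pos: "A1 > 0" "A2 > 0" "A3 > 0" using r by (simp_all add: A1_def A2_def A3_def)
    have m: "r powr (- \<alpha>) * r powr (- \<alpha> - 1) = A1" "r powr (- \<alpha>) * r powr (- 2 * \<alpha> - 1 - 1) = A3"
      using r by (simp_all add: A1_def A3_def flip: powr_add)
    define B where "B = r powr (- \<alpha>)"
    note m' = m[folded A2_def B_def]
    have [simp]: "u (r *\<^sub>R circ t) = B *\<^sub>R U t"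
      "partial_derivative i u (r *\<^sub>R circ t) = A2 *\<^sub>R angular_partial i (- \<alpha>) U U' t"
      "partial_derivative i p (r *\<^sub>R circ t) = A1 * angular_partial i (- 2 * \<alpha>) P P' t"
      "\<rho> (r *\<^sub>R circ t) = A1 * R t"
      "partial_derivative i \<rho> (r *\<^sub>R circ t)
        = r powr (- 2 * \<alpha> - 1 - 1) * angular_partial i (- 2 * \<alpha> - 1) R R' t" for i
      using polar_formD[OF u r] polar_formD[OF du r] polar_formD[OF dp r]
        polar_formD[OF \<rho> r] polar_formD[OF d\<rho> r]
      by (simp_all only: A1_def A2_def B_def real_scaleR_def)
    have 1: "(advection u u (r *\<^sub>R circ t) + grad p (r *\<^sub>R circ t)) $ 1 =
      A1 * (b t * U' t $ 1 - \<alpha> * a t * U t $ 1 - 2 * \<alpha> * P t * cos t - P' t * sin t)"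
      by (simp add: advection_def grad_def sum_2 angular_partial_1 angular_partial_2 a_def b_def
          algebra_simps flip: m'(1))
    have 2: "(advection u u (r *\<^sub>R circ t) + grad p (r *\<^sub>R circ t)) $ 2 =
      A1 * (b t * U' t $ 2 - \<alpha> * a t * U t $ 2 - 2 * \<alpha> * P t * sin t + P' t * cos t)"
      by (simp add: advection_def grad_def sum_2 angular_partial_1 angular_partial_2 a_def b_def
          algebra_simps flip: m'(1))
    have 3: "divergence u (r *\<^sub>R circ t) = A2 * (U' t $ 2 * cos t - U' t $ 1 * sin t - \<alpha> * a t)"
      by (simp add: divergence_def sum_2 angular_partial_1 angular_partial_2 a_def algebra_simps)
    have 4: "advection u \<rho> (r *\<^sub>R circ t) = A3 * (b t * R' t - (2 * \<alpha> + 1) * a t * R t)"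
      by (simp add: advection_def sum_2 angular_partial_1 angular_partial_2 a_def b_def
          algebra_simps flip: m'(2))
    have 5: "\<rho> (r *\<^sub>R circ t) = A1 * R t" by simp
    have 6: "A1 * z = - (A1 * R t) \<longleftrightarrow> z = - R t" for z
      using pos(1) by (metis less_irrefl mult_left_cancel mult_minus_right)
    show ?thesis
      unfolding vec2_eq_iff 1 2 3 4 5 using pos by (simp add: axis_def 6)
  qed
  have "(\<forall>x\<in>punctured_plane. Q x) \<longleftrightarrow> (\<forall>r>0. \<forall>t. Q (r *\<^sub>R circ t))" for Q
  proof (intro iffI ballI)
    fix x :: "real^2" assume "\<forall>r>0. \<forall>t. Q (r *\<^sub>R circ t)" "x \<in> punctured_plane"
    then show "Q x" using polar_decomposition[of x] by (metis Diff_iff singletonI zero_less_norm_iff)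
  qed simp
  note all = this
  have swap: "(\<forall>r>0::real. \<forall>t::real. F r t) \<longleftrightarrow> (\<forall>t. G t)"
    if "\<And>r t. r > 0 \<Longrightarrow> F r t \<longleftrightarrow> G t" for F G
    using that zero_less_one by blast
  show ?thesis
    unfolding stationary_boussinesq_def all by (rule swap) (rule E)
qed

lemma frame_components:
  "(x *\<^sub>R circ t + y *\<^sub>R circ (t + pi / 2)) $ 1 = x * cos t - y * sin t"
  "(x *\<^sub>R circ t + y *\<^sub>R circ (t + pi / 2)) $ 2 = x * sin t + y * cos t"
  by (simp_all add: cos_add sin_add)

lemma circ_eq_axis: "circ t = cos t *\<^sub>R axis 1 1 + sin t *\<^sub>R axis 2 1"
  by (simp add: vec2_eq_iff axis_def)

lemma circ_has_vector_derivative: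
  "(circ has_vector_derivative circ (t + pi / 2)) (at t)"
proof -
  have "((\<lambda>t. cos t *\<^sub>R axis 1 1 + sin t *\<^sub>R axis 2 1 :: real^2) has_vector_derivative
      (- sin t) *\<^sub>R axis 1 1 + cos t *\<^sub>R axis 2 1) (at t)"
    by (auto intro!: derivative_eq_intros simp: has_real_derivative_iff_has_vector_derivative[symmetric])
  then show ?thesis by (simp add: circ_eq_axis[abs_def] cos_add sin_add)
qed

lemma frame_has_vector_derivative:
  assumes "(a has_real_derivative a') (at t)" "(b has_real_derivative b') (at t)"
  shows "((\<lambda>t. a t *\<^sub>R circ t + b t *\<^sub>R circ (t + pi / 2)) has_vector_derivative
    (a' - b t) *\<^sub>R circ t + (a t + b') *\<^sub>R circ (t + pi / 2)) (at t)"
proof -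
  have "((\<lambda>t. circ (t + pi / 2)) has_vector_derivative - circ t) (at t)"
  proof -
    have "((\<lambda>t. t + pi / 2) has_vector_derivative 1) (at t)"
      by (auto intro!: derivative_eq_intros)
    from vector_diff_chain_at[OF this circ_has_vector_derivative]
    have "((\<lambda>t. circ (t + pi / 2)) has_vector_derivative circ (t + pi / 2 + pi / 2)) (at t)"
      by (simp add: o_def)
    moreover have "circ (t + pi / 2 + pi / 2) = - circ t"
      by (simp add: vec2_eq_iff cos_add sin_add)
    ultimately show ?thesis by simp
  qed
  from has_vector_derivative_add[OF has_vector_derivative_scaleR[OF assms(1) circ_has_vector_derivative]
      has_vector_derivative_scaleR[OF assms(2) this]]
  show ?thesis by (simp add: algebra_simps)
qed

text \<open>The momentum equation is rotated into the moving frame. Incompressibility turns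
  \<open>a + b'\<close> into \<open>\<alpha> * a\<close>, so the advection terms of the angular
  component cancel and only \<open>P' = - R * cos t\<close> remains. The equivalence serves both
  non-existence and existence.\<close>

theorem polar_form_boussinesq_frame:
  assumes u: "polar_form u (- \<alpha>) (\<lambda>t. a t *\<^sub>R circ t + b t *\<^sub>R circ (t + pi / 2))"
    and p: "polar_form p (- 2 * \<alpha>) P" and \<rho>: "polar_form \<rho> (- 2 * \<alpha> - 1) R"
    and a: "\<And>t. (a has_real_derivative a' t) (at t)"
    and b: "\<And>t. (b has_real_derivative b' t) (at t)"
    and P: "\<And>t. (P has_real_derivative P' t) (at t)"
    and R: "\<And>t. (R has_real_derivative R' t) (at t)"
  shows "stationary_boussinesq punctured_plane u p \<rho> \<longleftrightarrow>
    (\<forall>t. b t * a' t - \<alpha> * (a t)\<^sup>2 - (b t)\<^sup>2 - 2 * \<alpha> * P t = - R t * sin t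
       \<and> P' t = - R t * cos t
       \<and> b' t = (\<alpha> - 1) * a t
       \<and> b t * R' t = (2 * \<alpha> + 1) * a t * R t)"
proof -
  have fr: "(x * cos t - y * sin t) * cos t + (x * sin t + y * cos t) * sin t = x"
    "(x * sin t + y * cos t) * cos t - (x * cos t - y * sin t) * sin t = y" for x y t :: real
    by (simp_all add: algebra_simps sin_mult_sin)
  \<comment> \<open>Rotation by \<open>t\<close> is invertible, so the Cartesian components vanish
    exactly when the radial and angular ones do.\<close>
  have rot: "X = 0 \<and> Y = - R \<longleftrightarrow> X * cos t + Y * sin t = - R * sin t \<and> Y * cos t - X * sin t = - R * cos t"
    for X Y R t :: real
  proof
    assume "X * cos t + Y * sin t = - R * sin t \<and> Y * cos t - X * sin t = - R * cos t"
    then have e: "X * cos t + Y * sin t = - R * sin t" "Y * cos t - X * sin t = - R * cos t"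
      by simp_all
    have "X = (X * cos t + Y * sin t) * cos t - (Y * cos t - X * sin t) * sin t"
      by (simp add: algebra_simps sin_mult_sin)
    moreover have "Y = (X * cos t + Y * sin t) * sin t + (Y * cos t - X * sin t) * cos t"
      by (simp add: algebra_simps sin_mult_sin)
    ultimately show "X = 0 \<and> Y = - R"
      unfolding e by (simp add: algebra_simps sin_mult_sin)
  qed simp
  define X1 X2 where "X1 t = b t * ((a' t - b t) * cos t - (a t + b' t) * sin t)
      - \<alpha> * a t * (a t * cos t - b t * sin t) - 2 * \<alpha> * P t * cos t - P' t * sin t"
    and "X2 t = b t * ((a' t - b t) * sin t + (a t + b' t) * cos t)
      - \<alpha> * a t * (a t * sin t + b t * cos t) - 2 * \<alpha> * P t * sin t + P' t * cos t" for t
  have 1: "X1 t * cos t + X2 t * sin t = b t * (a' t - b t) - \<alpha> * a t * a t - 2 * \<alpha> * P t" for t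
    unfolding X1_def X2_def by (simp add: algebra_simps sin_mult_sin)
  have 2: "X2 t * cos t - X1 t * sin t = b t * (a t + b' t) - \<alpha> * a t * b t + P' t" for t
    unfolding X1_def X2_def by (simp add: algebra_simps sin_mult_sin)
  show ?thesis
    unfolding polar_form_boussinesq[OF u p \<rho> frame_has_vector_derivative[OF a b] P R]
      frame_components fr X1_def[symmetric] X2_def[symmetric]
  proof (intro all_cong1)
    fix t
    show "X1 t = 0 \<and> X2 t = - R t \<and> a t + b' t = \<alpha> * a t \<and> b t * R' t = (2 * \<alpha> + 1) * a t * R t \<longleftrightarrow>
      b t * a' t - \<alpha> * (a t)\<^sup>2 - (b t)\<^sup>2 - 2 * \<alpha> * P t = - R t * sin t \<and> P' t = - R t * cos t
      \<and> b' t = (\<alpha> - 1) * a t \<and> b t * R' t = (2 * \<alpha> + 1) * a t * R t"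
    \<comment> \<open>If incompressibility fails, both sides are false; otherwise it may be used to
      simplify the angular component.\<close>
    proof (cases "b' t = (\<alpha> - 1) * a t")
      case True
      then have ab: "a t + b' t = \<alpha> * a t" by (simp add: algebra_simps)
      have "X1 t = 0 \<and> X2 t = - R t \<longleftrightarrow>
        b t * a' t - \<alpha> * (a t)\<^sup>2 - (b t)\<^sup>2 - 2 * \<alpha> * P t = - R t * sin t \<and> P' t = - R t * cos t"
        unfolding rot[of "X1 t" "X2 t" "R t" t] 1 2 ab by (simp add: power2_eq_square algebra_simps)
      then show ?thesis using True ab by blast
    next
      case False
      then have "a t + b' t \<noteq> \<alpha> * a t" by (auto simp: algebra_simps)
      then show ?thesis using False by blast
    qed
  qed
qed

text \<open>The profile is the curl in polar coordinates: the radial derivative of r times the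
  angular velocity, minus the angular derivative of the radial velocity, divided by r.\<close>

lemma polar_form_vorticity:
  assumes u: "polar_form u (- \<alpha>) (\<lambda>t. a t *\<^sub>R circ t + b t *\<^sub>R circ (t + pi / 2))"
    and a: "\<And>t. (a has_real_derivative a' t) (at t)"
    and b: "\<And>t. (b has_real_derivative b' t) (at t)"
  shows "polar_form (vorticity u) (- \<alpha> - 1) (\<lambda>t. (1 - \<alpha>) * b t - a' t)"
proof -
  note pd = polar_form_partial_derivative[OF u frame_has_vector_derivative[OF a b]]
  have "angular_partial 1 (- \<alpha>) (\<lambda>t. a t *\<^sub>R circ t + b t *\<^sub>R circ (t + pi / 2))
      (\<lambda>t. (a' t - b t) *\<^sub>R circ t + (a t + b' t) *\<^sub>R circ (t + pi / 2)) t $ 2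
    - angular_partial 2 (- \<alpha>) (\<lambda>t. a t *\<^sub>R circ t + b t *\<^sub>R circ (t + pi / 2))
      (\<lambda>t. (a' t - b t) *\<^sub>R circ t + (a t + b' t) *\<^sub>R circ (t + pi / 2)) t $ 1 = (1 - \<alpha>) * b t - a' t" for t
    unfolding angular_partial_1 angular_partial_2 vector_minus_component vector_add_component
      vector_scaleR_component circ_nth
    by (simp add: sin_add cos_add algebra_simps sin_mult_sin)
  then show ?thesis
    using pd by (simp add: polar_form_def vorticity_def flip: right_diff_distrib)
qed

lemma polar_form_iff:
  "polar_form h s (\<lambda>t. h (circ t)) \<longleftrightarrow>
    (\<forall>x. x \<noteq> 0 \<longrightarrow> h x = norm x powr s *\<^sub>R h (x /\<^sub>R norm x))" (is "?L \<longleftrightarrow> ?R")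
proof
  assume L: ?L
  show ?R
  proof (intro allI impI)
    fix x :: "real^2" assume x: "x \<noteq> 0"
    obtain t where t: "norm x *\<^sub>R circ t = x" using polar_decomposition by blast
    have "x /\<^sub>R norm x = circ t" using x by (subst (1) t[symmetric]) simp
    then show "h x = norm x powr s *\<^sub>R h (x /\<^sub>R norm x)"
      using polar_formD[OF L, of "norm x" t] x t by simp
  qed
next
  assume R: ?R
  have "h (r *\<^sub>R circ t) = r powr s *\<^sub>R h (circ t)" if "r > 0" for r t
  proof -
    have "r *\<^sub>R circ t \<noteq> 0" using that by simp
    with R have "h (r *\<^sub>R circ t) = norm (r *\<^sub>R circ t) powr s *\<^sub>R h ((r *\<^sub>R circ t) /\<^sub>R norm (r *\<^sub>R circ t))"
      by blast
    then show ?thesis using that by simp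
  qed
  then show ?L by (simp add: polar_form_def)
qed

lemma neg_homogeneous_iff:
  "neg_homogeneous \<alpha> u p \<rho> \<longleftrightarrow> polar_form u (- \<alpha>) (\<lambda>t. u (circ t))
    \<and> polar_form p (- 2 * \<alpha>) (\<lambda>t. p (circ t)) \<and> polar_form \<rho> (- 2 * \<alpha> - 1) (\<lambda>t. \<rho> (circ t))"
  unfolding polar_form_iff neg_homogeneous_def by auto

subsection \<open>Rigidity of the angular system\<close>

text \<open>Chain rule along the unit circle, whose tangent at \<open>circ t\<close> is
  \<open>circ (t + pi / 2)\<close>.\<close>

lemma C1_circ_derivative:
  assumes "C_k_on 1 punctured_plane h"
  obtains g' where "\<And>t. ((\<lambda>t. h (circ t)) has_vector_derivative g' t) (at t)" "continuous_on UNIV g'"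
proof
  define g' where "g' t = - sin t *\<^sub>R partial_derivative 1 h (circ t) + cos t *\<^sub>R partial_derivative 2 h (circ t)" for t
  have cont_circ: "continuous_on UNIV circ"
    by (meson circ_has_vector_derivative continuous_at_imp_continuous_on has_vector_derivative_continuous)
  have "continuous_on punctured_plane (partial_derivative i h)" for i
    using assms by simp
  then have "continuous_on UNIV (\<lambda>t. partial_derivative i h (circ t))" for i
    by (rule continuous_on_compose2[OF _ cont_circ]) auto
  then show "continuous_on UNIV g'"
    unfolding g'_def by (intro continuous_intros)
  fix t
  have "h differentiable (at (circ t))" using assms by simp
  then have d: "(h has_derivative frechet_derivative h (at (circ t))) (at (circ t))"
    using frechet_derivative_works by blast
  interpret bounded_linear "frechet_derivative h (at (circ t))"
    using d by (rule has_derivative_bounded_linear)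
  have "circ (t + pi / 2) = - sin t *\<^sub>R axis 1 1 + cos t *\<^sub>R axis 2 1"
    by (simp add: circ_eq_axis cos_add sin_add)
  then have "frechet_derivative h (at (circ t)) (circ (t + pi / 2)) = g' t"
    by (simp only: add scale g'_def partial_derivative_def)
  then show "((\<lambda>t. h (circ t)) has_vector_derivative g' t) (at t)"
    using has_derivative_compose[OF circ_has_vector_derivative[of t, unfolded has_vector_derivative_def] d]
    by (simp add: has_vector_derivative_def scale)
qed

lemma C2_imp_C1:
  assumes "C_k_on 2 punctured_plane h"
  shows "C_k_on 1 punctured_plane h"
  using assms
  by (auto simp: numeral_2_eq_2 continuous_at_imp_continuous_on differentiable_imp_continuous_within)

section \<open>Transported quantities and their vanishing\<close>

text \<open>Were \<open>F x\<close> nonzero, take the zero of \<open>F\<close> between 0 and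
  \<open>x\<close> that is nearest to \<open>x\<close>. Beyond it \<open>F\<close> is constant, so
  continuity makes \<open>F x\<close> equal to the value at that zero.\<close>

lemma zero_if_stationary_where_nonzero:
  fixes F :: "real \<Rightarrow> real"
  assumes cont: "continuous_on UNIV F" and F0: "F 0 = 0"
    and d: "\<And>x. F x \<noteq> 0 \<Longrightarrow> (F has_real_derivative 0) (at x)"
  shows "F x = 0"
proof -
  have pos: "G x = 0" if cont: "continuous_on UNIV G" and G0: "G 0 = 0"
    and d: "\<And>x. G x \<noteq> 0 \<Longrightarrow> (G has_real_derivative 0) (at x)" and "x \<ge> 0" for G :: "real \<Rightarrow> real" and x
  proof (rule ccontr)
    assume nz: "G x \<noteq> 0"
    define S where "S = {0..x} \<inter> {y. G y = 0}"
    have "compact S" unfolding S_def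
      by (intro compact_Int_closed compact_Icc closed_Collect_eq cont continuous_on_const)
    moreover have "0 \<in> S" using G0 \<open>x \<ge> 0\<close> by (simp add: S_def)
    ultimately obtain s where s: "s \<in> S" "\<And>y. y \<in> S \<Longrightarrow> y \<le> s"
      using compact_attains_sup[of S] by auto
    have "s < x" using s(1) nz by (cases "s = x") (auto simp: S_def)
    moreover have "(G has_real_derivative 0) (at y)" if "s < y" "y < x" for y
      proof (rule d)
      have "y \<notin> S" using s(2) that by force
      then show "G y \<noteq> 0" using that s(1) by (auto simp: S_def)
    qed
    ultimately have "G x = G s"
      by (intro DERIV_isconst2[of s x G x] continuous_on_subset[OF cont]) auto
    then show False using nz s(1) by (simp add: S_def)
  qed
  show ?thesis
  proof (cases "x \<ge> 0")
    case False
    have "(\<lambda>x. F (- x)) (- x) = 0"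
    proof (rule pos[where G = "\<lambda>x. F (- x)"])
      show "continuous_on UNIV (\<lambda>x. F (- x))"
        by (rule continuous_on_compose2[OF cont]) (auto intro: continuous_intros)
      show "((\<lambda>x. F (- x)) has_real_derivative 0) (at y)" if "F (- y) \<noteq> 0" for y
        using DERIV_chain2[OF d[OF that] DERIV_minus[OF DERIV_ident]] by simp
    qed (use F0 False in auto)
    then show ?thesis by simp
  qed (use pos[of F] assms in auto)
qed

text \<open>The quantity \<open>g * \<bar>b\<bar> powr \<gamma>\<close> is locally constant where it does not vanish.\<close>

lemma transported_zero:
  fixes g b :: "real \<Rightarrow> real"
  assumes \<gamma>: "\<gamma> > 0" and g: "continuous_on UNIV g" and b0: "b 0 = 0"
    and b: "\<And>x. (b has_real_derivative b' x) (at x)"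
    and dg: "\<And>x. b x \<noteq> 0 \<Longrightarrow> \<exists>g'. (g has_real_derivative g') (at x) \<and> b x * g' + \<gamma> * b' x * g x = 0"
    and "b x \<noteq> 0"
  shows "g x = 0"
proof -
  have cb: "continuous_on UNIV b"
    by (meson b DERIV_isCont continuous_at_imp_continuous_on)
  \<comment> \<open>This is \<open>g * \<bar>b\<bar> powr \<gamma>\<close>; the square makes the
    base differentiable whatever the sign of \<open>b\<close>. As \<open>\<gamma> > 0\<close>, the
    product is continuous and vanishes at the zeros of \<open>b\<close>.\<close>
  define F where "F x = g x * ((b x)\<^sup>2) powr (\<gamma> / 2)" for x
  have "F x = 0"
  proof (rule zero_if_stationary_where_nonzero[where F = F])
    show "continuous_on UNIV F"
      unfolding F_def using \<gamma> by (intro continuous_intros g cb continuous_on_powr') auto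
    show "F 0 = 0" by (simp add: F_def b0)
    fix x assume "F x \<noteq> 0"
    then have nz: "b x \<noteq> 0" by (auto simp: F_def)
    then obtain g' where g': "(g has_real_derivative g') (at x)" and e: "b x * g' + \<gamma> * b' x * g x = 0"
      using dg by blast
    have "((\<lambda>x. (b x)\<^sup>2) has_real_derivative 2 * b x * b' x) (at x)"
      by (auto intro!: derivative_eq_intros b)
    from DERIV_fun_powr[OF this, of "\<gamma> / 2"]
    have "((\<lambda>x. ((b x)\<^sup>2) powr (\<gamma> / 2)) has_real_derivative
        \<gamma> / 2 * ((b x)\<^sup>2) powr (\<gamma> / 2 - 1) * (2 * b x * b' x)) (at x)"
      using nz by simp
    from DERIV_mult[OF g' this]
    have "(F has_real_derivative g' * ((b x)\<^sup>2) powr (\<gamma> / 2)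
        + \<gamma> / 2 * ((b x)\<^sup>2) powr (\<gamma> / 2 - 1) * (2 * b x * b' x) * g x) (at x)"
      by (simp add: F_def[abs_def])
    moreover have "((b x)\<^sup>2) powr (\<gamma> / 2) = ((b x)\<^sup>2) powr (\<gamma> / 2 - 1) * (b x)\<^sup>2"
      using nz by (simp add: powr_diff)
    then have "g' * ((b x)\<^sup>2) powr (\<gamma> / 2)
        + \<gamma> / 2 * ((b x)\<^sup>2) powr (\<gamma> / 2 - 1) * (2 * b x * b' x) * g x
      = ((b x)\<^sup>2) powr (\<gamma> / 2 - 1) * b x * (b x * g' + \<gamma> * b' x * g x)"
      by (simp add: power2_eq_square algebra_simps)
    ultimately show "(F has_real_derivative 0) (at x)" using e by simp
  qed
  then show ?thesis using \<open>b x \<noteq> 0\<close> by (simp add: F_def)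
qed

lemma eventually_nonzero:
  fixes f :: "real \<Rightarrow> real"
  assumes "isCont f x" "f x \<noteq> 0"
  shows "\<forall>\<^sub>F y in nhds x. f y \<noteq> 0"
  using assms tendsto_imp_eventually_ne[of f "f x" "at x" 0]
  by (auto simp: isCont_def eventually_nhds_conv_at)

lemma DERIV_local_eq:
  fixes f g :: "real \<Rightarrow> real"
  assumes "\<forall>\<^sub>F y in nhds x. f y = g y" "(f has_real_derivative f') (at x)" "(g has_real_derivative g') (at x)"
  shows "f' = g'"
  using assms DERIV_cong_ev[OF refl assms(1) refl] DERIV_unique by blast

text \<open>The system of \<open>polar_form_boussinesq_frame\<close>. The conditions at angle 0
  express the symmetry, since the odd fields vanish on the ray fixed by the reflection; they anchor
  the transported quantities.\<close>

locale angular_system =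
  fixes \<alpha> :: real and a b P R a' R' :: "real \<Rightarrow> real"
  assumes a: "\<And>t. (a has_real_derivative a' t) (at t)"
    and b: "\<And>t. (b has_real_derivative (\<alpha> - 1) * a t) (at t)"
    and P: "\<And>t. (P has_real_derivative - R t * cos t) (at t)"
    and R: "\<And>t. (R has_real_derivative R' t) (at t)"
    and ca': "continuous_on UNIV a'" and cR': "continuous_on UNIV R'"
    and radial: "\<And>t. b t * a' t - \<alpha> * (a t)\<^sup>2 - (b t)\<^sup>2 - 2 * \<alpha> * P t = - R t * sin t"
    and density: "\<And>t. b t * R' t = (2 * \<alpha> + 1) * a t * R t"
    and b0: "b 0 = 0" and R0: "R 0 = 0"
begin

lemma isCont [simp]: "isCont a t" "isCont b t" "isCont P t" "isCont R t" "isCont a' t" "isCont R' t"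
  using a b P R DERIV_isCont ca' cR' continuous_on_eq_continuous_at[OF open_UNIV] by blast+

text \<open>Here \<open>b\<close> is constant, hence 0. Where \<open>a\<close> is nonzero the
  density equation gives \<open>R = 0\<close>; then \<open>P\<close> has derivative 0 and equals
  \<open>- a\<^sup>2 / 2\<close>, so \<open>a' = 0\<close>. Where \<open>a\<close> vanishes on an
  interval, so does \<open>a'\<close>.\<close>

lemma vorticity_zero_1:
  assumes "\<alpha> = 1"
  shows "b t = 0" "a' t = 0"
proof -
  show b_eq: "b t = 0" for t
    using DERIV_isconst_all[of b t 0] b b0 assms by simp
  have *: "a' t = 0" if "a t \<noteq> 0" for t
  proof -
    have ev: "\<forall>\<^sub>F s in nhds t. a s \<noteq> 0" using that by (intro eventually_nonzero) auto
    have R_eq: "R s = 0" if "a s \<noteq> 0" for s using density[of s] that assms by (simp add: b_eq)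
    have "P s = - (a s)\<^sup>2 / 2" if "a s \<noteq> 0" for s
      using radial[of s] R_eq[OF that] by (simp add: b_eq assms)
    with ev have "\<forall>\<^sub>F s in nhds t. P s = - (a s)\<^sup>2 / 2"
      by (auto elim: eventually_mono)
    moreover have "(P has_real_derivative 0) (at t)" using P[of t] R_eq[OF that] by simp
    moreover have "((\<lambda>s. - (a s)\<^sup>2 / 2) has_real_derivative - (a t * a' t)) (at t)"
      by (auto intro!: derivative_eq_intros a)
    ultimately have "0 = - (a t * a' t)" by (rule DERIV_local_eq)
    then show ?thesis using that by simp
  qed
  show "a' t = 0"
  proof (rule ccontr)
    assume "a' t \<noteq> 0"
    then have "\<forall>\<^sub>F s in nhds t. a' s \<noteq> 0" by (intro eventually_nonzero) auto
    then have "\<forall>\<^sub>F s in nhds t. a s = 0" by (rule eventually_mono) (use * in blast)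
    then have "a' t = 0" by (rule DERIV_local_eq[OF _ a]) simp
    with \<open>a' t \<noteq> 0\<close> show False by simp
  qed
qed

lemma no_density_where_moving:
  assumes "- 1 / 2 \<le> \<alpha>" "\<alpha> < 1" "b t \<noteq> 0"
  shows "R t = 0"
proof (cases "\<alpha> = - 1 / 2")
  case False
  \<comment> \<open>With \<open>b' = (\<alpha> - 1) * a\<close>, this exponent turns the density
    equation into \<open>b * R' + \<gamma> * b' * R = 0\<close>.\<close>
  define \<gamma> where "\<gamma> = (2 * \<alpha> + 1) / (1 - \<alpha>)"
  have "\<gamma> * (\<alpha> - 1) = - (2 * \<alpha> + 1)" using assms(2) by (simp add: \<gamma>_def field_simps)
  then have \<gamma>1: "\<gamma> * ((\<alpha> - 1) * y) * z = - ((2 * \<alpha> + 1) * y * z)" for y z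
    by (metis mult.assoc mult_minus_left)
  show ?thesis
  proof (rule transported_zero[where g = R and b = b and \<gamma> = \<gamma>])
    show "\<gamma> > 0" using assms False by (simp add: \<gamma>_def)
    show "continuous_on UNIV R" by (simp add: continuous_at_imp_continuous_on)
    show "\<exists>g'. (R has_real_derivative g') (at x) \<and> b x * g' + \<gamma> * ((\<alpha> - 1) * a x) * R x = 0" for x
      using R[of x] density[of x] by (intro exI[of _ "R' x"]) (simp add: \<gamma>1)
  qed (use b b0 assms in auto)
next
  case \<alpha>: True
  have moving: "R' s = 0" if "b s \<noteq> 0" for s
    using density[of s] that by (simp add: \<alpha>)
  \<comment> \<open>On an interval where \<open>R'\<close> is nonzero, \<open>b\<close> and hence
    \<open>a\<close> vanish, so the radial equation reads \<open>P = - R * sin\<close>. Comparison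
    with \<open>P' = - R * cos\<close> gives \<open>R' * sin = 0\<close>, and \<open>sin\<close>
    cannot vanish on an interval.\<close>
  have "R' s = 0" for s
  proof (rule ccontr)
    assume "R' s \<noteq> 0"
    then have "\<forall>\<^sub>F x in nhds s. R' x \<noteq> 0" by (intro eventually_nonzero) auto
    then have ev: "\<forall>\<^sub>F x in nhds s. R' x \<noteq> 0 \<and> b x = 0" by (rule eventually_mono) (use moving in blast)
    have "sin x = 0" if "\<forall>\<^sub>F z in nhds x. R' z \<noteq> 0 \<and> b z = 0" for x
    proof -
      have "\<forall>\<^sub>F y in nhds x. \<forall>\<^sub>F z in nhds y. b z = 0"
        using that by (simp add: eventually_eventually eventually_conj_iff)
      moreover have "a y = 0" if "\<forall>\<^sub>F z in nhds y. b z = 0" for y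
      proof -
        have "(\<alpha> - 1) * a y = 0" by (rule DERIV_local_eq[OF that b]) simp
        then show ?thesis by (simp add: \<alpha>)
      qed
      ultimately have "\<forall>\<^sub>F y in nhds x. a y = 0" by (auto elim: eventually_mono)
      with that have "\<forall>\<^sub>F y in nhds x. P y = - R y * sin y"
      proof eventually_elim
        case (elim y)
        then show ?case using radial[of y] by (simp add: \<alpha>)
      qed
      moreover have "((\<lambda>y. - R y * sin y) has_real_derivative - R' x * sin x - R x * cos x) (at x)"
        by (auto intro!: derivative_eq_intros R)
      ultimately have "- R x * cos x = - R' x * sin x - R x * cos x"
        by (rule DERIV_local_eq[OF _ P])
      moreover have "R' x \<noteq> 0" using eventually_nhds_x_imp_x[OF that] by simp
      ultimately show ?thesis by simp
    qed
    moreover have "\<forall>\<^sub>F x in nhds s. \<forall>\<^sub>F z in nhds x. R' z \<noteq> 0 \<and> b z = 0"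
      using ev by (simp only: eventually_eventually)
    ultimately have ev0: "\<forall>\<^sub>F x in nhds s. sin x = 0" by (auto elim: eventually_mono)
    then have "cos s = 0" by (rule DERIV_local_eq[OF _ DERIV_sin]) simp
    with eventually_nhds_x_imp_x[OF ev0] show False
      using sin_zero_abs_cos_one by fastforce
  qed
  then have "R t = R 0" using DERIV_isconst_all[of R t 0] R by simp
  then show ?thesis by (simp add: R0)
qed

text \<open>Although \<open>a'\<close> is only continuous, the radial equation can be solved for it
  where \<open>b\<close> is nonzero. This makes the vorticity profile \<open>w\<close>
  differentiable there, with \<open>b * w' = (\<alpha> + 1) * a * w\<close>.\<close>

lemma vorticity_zero:
  assumes \<alpha>: "- 1 / 2 \<le> \<alpha>" "\<alpha> < 1"
  shows "a' t = (1 - \<alpha>) * b t"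
proof -
  define w where "w t = (1 - \<alpha>) * b t - a' t" for t
  have moving: "w t = 0" if "b t \<noteq> 0" for t
  proof -
    define \<gamma> where "\<gamma> = (\<alpha> + 1) / (1 - \<alpha>)"
    have "\<gamma> * (\<alpha> - 1) = - (\<alpha> + 1)" using \<alpha>(2) by (simp add: \<gamma>_def field_simps)
    then have \<gamma>1: "\<gamma> * ((\<alpha> - 1) * y) * z = - ((\<alpha> + 1) * y * z)" for y z
      by (metis mult.assoc mult_minus_left)
    show ?thesis
    proof (rule transported_zero[where g = w and b = b and \<gamma> = \<gamma>])
      show "\<gamma> > 0" using \<alpha> by (simp add: \<gamma>_def)
      show "continuous_on UNIV w"
        unfolding w_def by (intro continuous_at_imp_continuous_on ballI continuous_intros isCont)
      fix x assume nz: "b x \<noteq> 0"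
      have "\<forall>\<^sub>F y in nhds x. b y \<noteq> 0" using nz by (intro eventually_nonzero) auto
      \<comment> \<open>Where \<open>b\<close> is nonzero the density vanishes, so \<open>w\<close>
        is locally a differentiable expression in \<open>a\<close>, \<open>b\<close> and
        \<open>P\<close>.\<close>
      then have ev: "\<forall>\<^sub>F y in nhds x. (1 - \<alpha>) * b y - (\<alpha> * (a y)\<^sup>2 + (b y)\<^sup>2 + 2 * \<alpha> * P y) / b y = w y"
      proof eventually_elim
        case (elim y)
        then show ?case
          using radial[of y] no_density_where_moving[OF \<alpha> elim] by (simp add: w_def field_simps)
      qed
      have P0: "(P has_real_derivative 0) (at x)"
        using P[of x] no_density_where_moving[OF \<alpha> nz] by simp
      define N where "N = \<alpha> * (a x)\<^sup>2 + (b x)\<^sup>2 + 2 * \<alpha> * P x"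
      have N: "N = b x * a' x"
        using radial[of x] no_density_where_moving[OF \<alpha> nz] by (simp add: N_def)
      define d where "d = (1 - \<alpha>) * ((\<alpha> - 1) * a x) - ((2 * \<alpha> * a x * a' x + 2 * b x * ((\<alpha> - 1) * a x)) * b x
          - N * ((\<alpha> - 1) * a x)) / (b x * b x)"
      have "((\<lambda>y. (1 - \<alpha>) * b y - (\<alpha> * (a y)\<^sup>2 + (b y)\<^sup>2 + 2 * \<alpha> * P y) / b y) has_real_derivative d) (at x)"
        using nz unfolding d_def N_def
        by (auto intro!: derivative_eq_intros a b P0)
      then have "(w has_real_derivative d) (at x)"
        using DERIV_cong_ev[OF refl ev refl] by simp
      moreover have "b x * d + \<gamma> * ((\<alpha> - 1) * a x) * w x = 0"
      proof -
        have "b x * d = (\<alpha> + 1) * a x * w x"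
          using nz unfolding d_def N w_def by (simp add: field_simps)
        then show ?thesis by (simp add: \<gamma>1)
      qed
      ultimately show "\<exists>g'. (w has_real_derivative g') (at x) \<and> b x * g' + \<gamma> * ((\<alpha> - 1) * a x) * w x = 0"
        by blast
    qed (use b b0 that in auto)
  qed
  \<comment> \<open>A point with \<open>w\<close> nonzero has a neighbourhood on which
    \<open>b\<close> is 0; there \<open>a\<close> and \<open>a'\<close> vanish too, hence also
    \<open>w\<close>.\<close>
  have "w t = 0"
  proof (rule ccontr)
    assume "w t \<noteq> 0"
    then have "\<forall>\<^sub>F s in nhds t. w s \<noteq> 0"
      unfolding w_def by (intro eventually_nonzero continuous_intros isCont)
    then have ev: "\<forall>\<^sub>F s in nhds t. b s = 0" by (rule eventually_mono) (use moving in blast)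
    then have "\<forall>\<^sub>F s in nhds t. \<forall>\<^sub>F s in nhds s. b s = 0" by (simp only: eventually_eventually)
    then have "\<forall>\<^sub>F s in nhds t. a s = 0"
    proof eventually_elim
      case (elim s)
      have "(\<alpha> - 1) * a s = 0" by (rule DERIV_local_eq[OF elim b]) simp
      then show ?case using \<alpha> by simp
    qed
    then have "a' t = 0" by (rule DERIV_local_eq[OF _ a]) simp
    then show False using \<open>w t \<noteq> 0\<close> eventually_nhds_x_imp_x[OF ev] by (simp add: w_def)
  qed
  then show ?thesis by (simp add: w_def)
qed

end

text \<open>Both regularity classes are treated together by passing to C^1. The fields on the unit
  circle satisfy the angular system, whose vorticity is zero, and homogeneity carries this to every
  ray.\<close>

theorem no_rotational_solution:
  assumes \<alpha>: "- 1 / 2 \<le> \<alpha>" "\<alpha> \<le> 1" and k: "k = 1 \<or> k = 2"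
  shows "\<not> rotational_homogeneous_symmetric_solution k punctured_plane \<alpha> u p \<rho>"
proof
  assume sol: "rotational_homogeneous_symmetric_solution k punctured_plane \<alpha> u p \<rho>"
  then have C1: "C_k_on 1 punctured_plane u" "C_k_on 1 punctured_plane p" "C_k_on 1 punctured_plane \<rho>"
    using k C2_imp_C1 unfolding rotational_homogeneous_symmetric_solution_def by blast+
  obtain U' P' R' where U: "\<And>t. ((\<lambda>t. u (circ t)) has_vector_derivative U' t) (at t)" "continuous_on UNIV U'"
    and P: "\<And>t. ((\<lambda>t. p (circ t)) has_vector_derivative P' t) (at t)"
    and R: "\<And>t. ((\<lambda>t. \<rho> (circ t)) has_vector_derivative R' t) (at t)" "continuous_on UNIV R'"
    using C1[THEN C1_circ_derivative] by metis
  define a b where "a t = u (circ t) $ 1 * cos t + u (circ t) $ 2 * sin t"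
    and "b t = u (circ t) $ 2 * cos t - u (circ t) $ 1 * sin t" for t
  define a' b' where "a' t = U' t $ 1 * cos t + U' t $ 2 * sin t + b t"
    and "b' t = U' t $ 2 * cos t - U' t $ 1 * sin t - a t" for t
  have dU: "((\<lambda>t. u (circ t) $ i) has_real_derivative U' t $ i) (at t)" for i t
    using bounded_linear.has_vector_derivative[OF bounded_linear_vec_nth U(1)]
    by (simp add: has_real_derivative_iff_has_vector_derivative)
  have da: "(a has_real_derivative a' t) (at t)" for t
    unfolding a_def[abs_def] a'_def b_def by (auto intro!: derivative_eq_intros dU)
  have db: "(b has_real_derivative b' t) (at t)" for t
    unfolding b_def[abs_def] b'_def a_def by (auto intro!: derivative_eq_intros dU)
  have hom: "polar_form u (- \<alpha>) (\<lambda>t. u (circ t))" "polar_form p (- 2 * \<alpha>) (\<lambda>t. p (circ t))"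
    "polar_form \<rho> (- 2 * \<alpha> - 1) (\<lambda>t. \<rho> (circ t))"
    using sol neg_homogeneous_iff by (auto simp: rotational_homogeneous_symmetric_solution_def)
  have frame: "u (circ t) = a t *\<^sub>R circ t + b t *\<^sub>R circ (t + pi / 2)" for t
    unfolding vec2_eq_iff frame_components by (simp add: a_def b_def algebra_simps sin_mult_sin)
  note u = hom(1)[unfolded frame]
  have dP: "((\<lambda>t. p (circ t)) has_real_derivative P' t) (at t)"
    and dR: "((\<lambda>t. \<rho> (circ t)) has_real_derivative R' t) (at t)" for t
    using P R(1) by (auto simp: has_real_derivative_iff_has_vector_derivative)
  have eqs: "b t * a' t - \<alpha> * (a t)\<^sup>2 - (b t)\<^sup>2 - 2 * \<alpha> * p (circ t) = - \<rho> (circ t) * sin t"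
    "P' t = - \<rho> (circ t) * cos t" "b' t = (\<alpha> - 1) * a t"
    "b t * R' t = (2 * \<alpha> + 1) * a t * \<rho> (circ t)" for t
    using polar_form_boussinesq_frame[OF u hom(2,3) da db dP dR] sol
    by (auto simp: rotational_homogeneous_symmetric_solution_def)
  \<comment> \<open>On the fixed ray of the reflection the odd fields equal their own
    negatives.\<close>
  have "circ 0 = vector [1, 0]" by (simp add: circ_def)
  then have "u (circ 0) $ 2 = 0" "\<rho> (circ 0) = 0"
    using sol unfolding rotational_homogeneous_symmetric_solution_def x2_symmetric_def
    by (metis (no_types, lifting) DiffI UNIV_I circ_nonzero empty_iff insert_iff neg_equal_zero minus_zero)+
  then have zero: "b 0 = 0" "\<rho> (circ 0) = 0" by (simp_all add: b_def)
  have ca': "continuous_on UNIV a'"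
  proof -
    have "continuous_on UNIV b" by (meson db DERIV_isCont continuous_at_imp_continuous_on)
    then show ?thesis
      unfolding a'_def[abs_def] by (intro continuous_intros U(2) continuous_on_component)
  qed
  interpret angular_system \<alpha> a b "\<lambda>t. p (circ t)" "\<lambda>t. \<rho> (circ t)" a' R'
    by unfold_locales (use da db dP dR eqs zero ca' R(2) in auto)
  have "(1 - \<alpha>) * b t - a' t = 0" for t
    using vorticity_zero_1 vorticity_zero \<alpha> by (cases "\<alpha> = 1") auto
  then have "vorticity u (r *\<^sub>R circ t) = 0" if "r > 0" for r t
    using polar_formD[OF polar_form_vorticity[OF u da db] that] by simp
  then have "vorticity u x = 0" if "x \<noteq> 0" for x
    using that polar_decomposition[of x] by (metis zero_less_norm_iff)
  then show False
    using sol by (auto simp: rotational_homogeneous_symmetric_solution_def rotational_def)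
qed

subsection \<open>Periodic solutions of a nonlinear oscillator\<close>

text \<open>Caratheodory's criterion with slope function \<open>g\<close> itself. It covers factors
  such as \<open>\<bar>x\<bar> powr q\<close>, which for small \<open>q\<close> has no derivative at
  0.\<close>

lemma DERIV_ident_mult_at_0:
  fixes g :: "real \<Rightarrow> real"
  assumes "isCont g 0"
  shows "((\<lambda>x. x * g x) has_real_derivative g 0) (at 0)"
  unfolding CARAT_DERIV using assms by (intro exI[of _ g]) (simp add: mult.commute)

lemma isCont_abs_powr:
  fixes x :: real
  assumes "q > 0"
  shows "isCont (\<lambda>x. \<bar>x\<bar> powr q) x"
proof -
  have "continuous_on UNIV (\<lambda>x::real. \<bar>x\<bar> powr q)"
    using assms by (intro continuous_on_powr' continuous_intros) auto
  then show ?thesis by (simp add: continuous_on_eq_continuous_at)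
qed

lemma DERIV_abs_powr:
  fixes x :: real
  assumes "x \<noteq> 0"
  shows "((\<lambda>x. \<bar>x\<bar> powr q) has_real_derivative q * \<bar>x\<bar> powr q / x) (at x)"
proof -
  have "(abs has_real_derivative sgn x) (at x)"
    using has_derivative_norm[OF assms] by (simp add: has_field_derivative_def real_norm_def[abs_def] mult.commute[of _ "sgn x"])
  from DERIV_fun_powr[OF this, of q]
  have "((\<lambda>x. \<bar>x\<bar> powr q) has_real_derivative q * \<bar>x\<bar> powr (q - 1) * sgn x) (at x)"
    using assms by simp
  moreover have "q * \<bar>x\<bar> powr (q - 1) * sgn x = q * \<bar>x\<bar> powr q / x"
    using assms by (simp add: powr_diff sgn_if)
  ultimately show ?thesis by simp
qed

lemma DERIV_mult_abs_powr:
  fixes x :: real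
  assumes "q > 0"
  shows "((\<lambda>x. x * \<bar>x\<bar> powr q) has_real_derivative (1 + q) * \<bar>x\<bar> powr q) (at x)"
proof (cases "x = 0")
  case True
  then show ?thesis using DERIV_ident_mult_at_0[OF isCont_abs_powr[OF assms]] by simp
next
  case False
  from DERIV_mult[OF DERIV_ident DERIV_abs_powr[OF this]] False show ?thesis
    by (simp add: algebra_simps)
qed

lemma strict_mono_if_DERIV_pos:
  fixes F :: "real \<Rightarrow> real"
  assumes "\<And>x. (F has_real_derivative F' x) (at x)" "\<And>x. F' x > 0"
  shows "strict_mono F"
  using assms by (intro strict_monoI DERIV_pos_imp_increasing[of _ _ F]) blast+

text \<open>The uniform lower bound on the derivative forces at least linear growth in both
  directions, whence surjectivity by the intermediate value theorem.\<close>

lemma DERIV_ge_imp_inverse: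
  fixes F :: "real \<Rightarrow> real"
  assumes F: "\<And>x. (F has_real_derivative F' x) (at x)" and \<epsilon>: "\<epsilon> > 0" "\<And>x. F' x \<ge> \<epsilon>"
  obtains H where "\<And>y. F (H y) = y" "\<And>x. H (F x) = x"
    "\<And>y. (H has_real_derivative inverse (F' (H y))) (at y)"
proof
  have cont: "isCont F x" for x using F DERIV_isCont by blast
  have "strict_mono F"
    using F less_le_trans[OF \<epsilon>] by (rule strict_mono_if_DERIV_pos)
  then have inj: "inj F" by (rule strict_mono_imp_inj_on)
  have growth: "F x + \<epsilon> * (y - x) \<le> F y" if "x \<le> y" for x y
  proof -
    have "(\<lambda>x. F x - \<epsilon> * x) x \<le> (\<lambda>x. F x - \<epsilon> * x) y"
    proof (rule DERIV_nonneg_imp_nondecreasing[OF that])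
      fix z
      show "\<exists>d. ((\<lambda>x. F x - \<epsilon> * x) has_real_derivative d) (at z) \<and> 0 \<le> d"
        by (rule exI[of _ "F' z - \<epsilon>"]) (auto intro!: derivative_eq_intros F simp: \<epsilon>(2))
    qed
    then show ?thesis by (simp add: algebra_simps)
  qed
  have "\<exists>x. F x = y" for y
  proof -
    define M where "M = \<bar>y - F 0\<bar> / \<epsilon>"
    have M: "M \<ge> 0" "\<epsilon> * M = \<bar>y - F 0\<bar>" using \<epsilon>(1) by (simp_all add: M_def)
    have "F (- M) \<le> y" "y \<le> F M" using growth[of "- M" 0] growth[of 0 M] M by auto
    then show ?thesis
      using IVT'[of F "- M" y M] M(1) cont by (auto intro: continuous_at_imp_continuous_on)
  qed
  then have surj: "surj F" by (metis surjI)
  show FH: "F (inv F y) = y" for y using surj by (simp add: surj_f_inv_f)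
  show HF: "inv F (F x) = x" for x using inj by simp
  show "(inv F has_real_derivative inverse (F' (inv F y))) (at y)" for y
  proof (rule DERIV_inverse_function[where f = F and a = "y - 1" and b = "y + 1"])
    show "F' (inv F y) \<noteq> 0" using \<epsilon> by (metis less_le_trans less_irrefl)
    have "isCont (inv F) (F (inv F y))"
      by (rule isCont_inverse_function[of 1]) (auto simp: HF cont)
    then show "isCont (inv F) y" by (simp add: FH)
  qed (use F FH in auto)
qed

text \<open>Dominated convergence with bound \<open>1 / \<mu>\<close>: away from the zeros of
  \<open>sin\<close> the argument of \<open>h\<close> is unbounded in absolute value, and evenness
  of \<open>h\<close> removes its sign.\<close>

lemma integral_reciprocal_sin_tendsto_0:
  fixes h :: "real \<Rightarrow> real"
  assumes h: "continuous_on UNIV h" and \<mu>: "\<mu> > 0" "\<And>y. h y \<ge> \<mu>" and even: "\<And>y. h (- y) = h y"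
    and lim: "((\<lambda>y. 1 / h y) \<longlongrightarrow> 0) at_top"
  shows "(\<lambda>k. integral {0..2 * pi} (\<lambda>x. 1 / h (real k * sin x))) \<longlonglongrightarrow> 0"
proof -
  \<comment> \<open>At the finitely many zeros of \<open>sin\<close> the integrand is frozen at the
    bound: convergence is trivial there and the integrals do not change.\<close>
  define g where "g x = (if sin x = 0 then 1 / \<mu> else 0)" for x :: real
  define f where "f k x = (if sin x = 0 then 1 / \<mu> else 1 / h (real k * sin x))" for k x
  have hpos: "h y > 0" for y using \<mu> by (meson less_le_trans)
  have zeros: "x \<in> {0, pi, 2 * pi}" if "x \<in> {0..2 * pi}" "sin x = 0" for x
    using that sin_gt_zero[of x] sin_lt_zero[of x] by force
  have cont: "continuous_on {0..2 * pi} (\<lambda>x. 1 / h (real k * sin x))" for k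
    using hpos by (intro continuous_intros continuous_on_compose2[OF h]) (auto simp: less_imp_neq[THEN not_sym])
  have int: "(f k has_integral integral {0..2 * pi} (\<lambda>x. 1 / h (real k * sin x))) {0..2 * pi}" for k
    by (rule has_integral_spike_finite[of "{0, pi, 2 * pi}", OF _ _ integrable_integral[OF integrable_continuous_real[OF cont]]])
      (use zeros in \<open>auto simp: f_def\<close>)
  have g: "(g has_integral 0) {0..2 * pi}"
    by (rule has_integral_spike_finite[of "{0, pi, 2 * pi}", OF _ _ has_integral_0])
      (use zeros in \<open>auto simp: g_def\<close>)
  have "(\<lambda>k. integral {0..2 * pi} (f k)) \<longlonglongrightarrow> integral {0..2 * pi} g"
  proof (rule dominated_convergence(2)[where h = "\<lambda>_. 1 / \<mu>"])
    show "f k integrable_on {0..2 * pi}" for k using int by blast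
    show "norm (f k x) \<le> 1 / \<mu>" for k x
      using \<mu>(1) \<mu>(2)[of "real k * sin x"] hpos[of "real k * sin x"] by (simp add: f_def frac_le)
    show "(\<lambda>k. f k x) \<longlonglongrightarrow> g x" for x
    proof (cases "sin x = 0")
      case False
      have "filterlim (\<lambda>k. \<bar>sin x\<bar> * real k) at_top sequentially"
        using False by (intro filterlim_tendsto_pos_mult_at_top[OF tendsto_const] filterlim_real_sequentially) auto
      from filterlim_compose[OF lim this] have "(\<lambda>k. 1 / h (\<bar>sin x\<bar> * real k)) \<longlonglongrightarrow> 0" .
      moreover have "h (\<bar>sin x\<bar> * real k) = h (real k * sin x)" for k
        using even[of "real k * sin x"] by (simp add: abs_if mult.commute)
      ultimately show ?thesis using False by (simp add: f_def g_def)
    qed (simp add: f_def g_def)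
  qed (rule integrable_const_ivl)
  then show ?thesis
    unfolding integral_unique[OF g] integral_unique[OF int] .
qed

text \<open>The period is \<open>2 * pi / \<mu>\<close> at amplitude 0 and tends to 0 along the
  integers. An integer \<open>n > \<mu>\<close> puts \<open>2 * pi / n\<close> strictly in between;
  strictness excludes amplitude 0.\<close>

lemma exists_commensurable_period:
  fixes h :: "real \<Rightarrow> real"
  assumes h: "continuous_on UNIV h" and \<mu>: "\<mu> > 0" "\<And>y. h y \<ge> \<mu>" and even: "\<And>y. h (- y) = h y"
    and lim: "((\<lambda>y. 1 / h y) \<longlongrightarrow> 0) at_top" and h0: "h 0 = \<mu>"
  obtains A :: real and n :: nat
  where "A > 0" "n * integral {0..2 * pi} (\<lambda>x. 1 / h (A * sin x)) = 2 * pi"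
proof -
  define T where "T A = integral {0..2 * pi} (\<lambda>x. 1 / h (A * sin x))" for A
  have hpos: "h y > 0" for y using \<mu> by (meson less_le_trans)
  have contT: "continuous_on UNIV T"
  proof -
    have "continuous_on UNIV (\<lambda>A. integral (cbox 0 (2 * pi)) (\<lambda>x. 1 / h (A * sin x)))"
      by (rule integral_continuous_on_param)
        (use hpos in \<open>auto simp: split_beta less_imp_neq[THEN not_sym] intro!: continuous_intros continuous_on_compose2[OF h]\<close>)
    then show ?thesis by (simp add: T_def[abs_def])
  qed
  obtain n :: nat where n: "\<mu> < n" using reals_Archimedean2 by blast
  have n0: "real n > 0" using n \<mu>(1) by linarith
  have T0: "T 0 = 2 * pi / \<mu>" by (simp add: T_def h0)
  have lt: "2 * pi / n < 2 * pi / \<mu>" using n \<mu>(1) by (simp add: divide_strict_left_mono)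
  have "(\<lambda>k. T (real k)) \<longlonglongrightarrow> 0"
    unfolding T_def by (rule integral_reciprocal_sin_tendsto_0[OF h \<mu> even lim])
  moreover have "2 * pi / n > 0" using n0 by simp
  ultimately have "\<forall>\<^sub>F k in sequentially. T (real k) < 2 * pi / n"
    by (rule order_tendstoD(2))
  then obtain k :: nat where k: "T (real k) < 2 * pi / n"
    unfolding eventually_sequentially by blast
  obtain A where A: "0 \<le> A" "T A = 2 * pi / n"
    using IVT2'[of T "real k" "2 * pi / n" 0] k lt T0 continuous_on_subset[OF contT] by force
  have "A \<noteq> 0" using A lt T0 by auto
  then show thesis using A n0 by (intro that[of A n]) (auto simp: T_def)
qed

text \<open>Separation of variables: the flow is the inverse of an antiderivative of
  \<open>k\<close>, normalised to vanish at 0. The integral of \<open>k\<close> is the time of one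
  full turn.\<close>

lemma angle_flow:
  fixes k :: "real \<Rightarrow> real"
  assumes k: "continuous_on UNIV k" and \<epsilon>: "\<epsilon> > 0" "\<And>x. k x \<ge> \<epsilon>"
    and even: "\<And>x. k (- x) = k x" and per: "\<And>x. k (x + 2 * pi) = k x"
  obtains \<Phi> where "\<And>t. (\<Phi> has_real_derivative inverse (k (\<Phi> t))) (at t)" "\<And>t. \<Phi> (- t) = - \<Phi> t"
    "\<And>t. \<Phi> (t + integral {0..2 * pi} k) = \<Phi> t + 2 * pi"
proof -
  have "\<exists>S. \<forall>x::real. -\<infinity> < ereal x \<longrightarrow> ereal x < \<infinity> \<longrightarrow> (S has_vector_derivative k x) (at x)"
    using k by (intro einterval_antiderivative) (auto simp: continuous_on_eq_continuous_at)
  then obtain S0 where S0: "\<And>x. (S0 has_real_derivative k x) (at x)"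
    by (auto simp: has_real_derivative_iff_has_vector_derivative)
  define S where "S x = S0 x - S0 0" for x
  have S: "(S has_real_derivative k x) (at x)" for x
    unfolding S_def[abs_def] by (auto intro!: derivative_eq_intros S0)
  have S00: "S 0 = 0" by (simp add: S_def)
  have odd: "S (- x) = - S x" for x
  proof -
    have "((\<lambda>x. S (- x) + S x) has_real_derivative 0) (at x)" for x
      using DERIV_add[OF DERIV_chain2[OF S DERIV_minus[OF DERIV_ident]] S] by (simp add: even)
    from DERIV_isconst_all[of "\<lambda>x. S (- x) + S x" x 0] this show ?thesis by (simp add: S00)
  qed
  define T where "T = integral {0..2 * pi} k"
  have "(k has_integral S (2 * pi) - S 0) {0..2 * pi}"
    using S by (intro fundamental_theorem_of_calculus)
      (auto simp: has_real_derivative_iff_has_vector_derivative[symmetric] intro: has_field_derivative_at_within)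
  then have T: "S (2 * pi) = T" by (simp add: T_def S00 integral_unique)
  have shift: "S (x + 2 * pi) = S x + T" for x
  proof -
    have "((\<lambda>x. S (x + 2 * pi) - S x) has_real_derivative 0) (at x)" for x
    proof -
      have "((\<lambda>x. S (x + 2 * pi)) has_real_derivative k (x + 2 * pi)) (at x)"
        using S[of "x + 2 * pi"] by (simp only: DERIV_shift)
      from DERIV_diff[OF this S] show ?thesis by (simp add: per)
    qed
    from DERIV_isconst_all[of "\<lambda>x. S (x + 2 * pi) - S x" x 0] this show ?thesis by (simp add: S00 T)
  qed
  obtain \<Phi> where \<Phi>: "\<And>y. S (\<Phi> y) = y" "\<And>x. \<Phi> (S x) = x"
    "\<And>y. (\<Phi> has_real_derivative inverse (k (\<Phi> y))) (at y)"
    using DERIV_ge_imp_inverse[OF S \<epsilon>] by blast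
  show thesis
  proof (rule that[OF \<Phi>(3)])
    show "\<Phi> (- t) = - \<Phi> t" for t using \<Phi> odd by metis
    show "\<Phi> (t + integral {0..2 * pi} k) = \<Phi> t + 2 * pi" for t
      using \<Phi> shift unfolding T_def by metis
  qed
qed

text \<open>With \<open>G f = f * sqrt (\<mu>\<^sup>2 + \<bar>f\<bar> powr q)\<close> the energy is \<open>f'\<^sup>2 + (G f)\<^sup>2 = A\<^sup>2\<close>. Writing
  \<open>f' = A * cos \<phi>\<close> and \<open>G f = A * sin \<phi>\<close> turns the oscillator into the first-order equation
  \<open>\<phi>' = G' f\<close>, whose right-hand side is a positive function of \<open>A * sin \<phi>\<close>. Its period drops from
  \<open>2 * pi / \<mu>\<close> to 0 as the amplitude grows, so it equals \<open>2 * pi / n\<close> for some \<open>n\<close> and \<open>A\<close>.\<close>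

theorem periodic_oscillation_exists:
  fixes \<mu> :: real
  assumes \<mu>: "\<mu> > 0"
  defines "q \<equiv> 2 / \<mu>"
  obtains f f' :: "real \<Rightarrow> real" and A :: real where "A > 0"
    "\<And>t. (f has_real_derivative f' t) (at t)"
    "\<And>t. (f' has_real_derivative - (f t * (\<mu>\<^sup>2 + (1 + 1 / \<mu>) * \<bar>f t\<bar> powr q))) (at t)"
    "\<And>t. (f' t)\<^sup>2 + (f t)\<^sup>2 * (\<mu>\<^sup>2 + \<bar>f t\<bar> powr q) = A\<^sup>2"
    "\<And>t. f (- t) = - f t" "\<And>t. f' (- t) = f' t"
    "\<And>t. f (t + 2 * pi) = f t" "\<And>t. f' (t + 2 * pi) = f' t"
proof -
  have q: "q > 0" "q / 2 = 1 / \<mu>" using \<mu> by (simp_all add: q_def)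
  define s where "s x = sqrt (\<mu>\<^sup>2 + \<bar>x\<bar> powr q)" for x
  define G where "G x = x * s x" for x
  define G' where "G' x = (\<mu>\<^sup>2 + (1 + 1 / \<mu>) * \<bar>x\<bar> powr q) / s x" for x
  have s2: "(s x)\<^sup>2 = \<mu>\<^sup>2 + \<bar>x\<bar> powr q" for x by (simp add: s_def)
  have s_ge: "s x \<ge> \<mu>" for x
    unfolding s_def by (rule real_le_rsqrt) simp
  have s_pos: "s x > 0" for x using s_ge[of x] \<mu> by linarith
  have s_cont: "isCont s x" for x
    unfolding s_def by (intro continuous_intros isCont_abs_powr q)
  have G'_ge_s: "G' x \<ge> s x" for x
  proof -
    have "s x * s x \<le> \<mu>\<^sup>2 + (1 + 1 / \<mu>) * \<bar>x\<bar> powr q"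
      using s2[of x] \<mu> by (simp add: power2_eq_square algebra_simps)
    then show ?thesis using s_pos[of x] by (simp add: G'_def le_divide_eq)
  qed
  then have G'_ge: "G' x \<ge> \<mu>" for x using s_ge order_trans by blast
  have G'_cont: "isCont G' x" for x
    unfolding G'_def using s_pos[of x] by (intro continuous_intros isCont_abs_powr q s_cont) auto
  have DG: "(G has_real_derivative G' x) (at x)" for x
  \<comment> \<open>The square root factor \<open>s\<close> need not be differentiable at 0, so
    there only its continuity is used.\<close>
  proof (cases "x = 0")
    case True
    then show ?thesis
      using DERIV_ident_mult_at_0[OF s_cont] \<mu> by (simp add: G_def[abs_def] G'_def s_def power2_eq_square)
  next
    case False
    have "((\<lambda>x. \<mu>\<^sup>2 + \<bar>x\<bar> powr q) has_real_derivative q * \<bar>x\<bar> powr q / x) (at x)"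
      using DERIV_add[OF DERIV_const DERIV_abs_powr[OF False]] by simp
    moreover have "\<mu>\<^sup>2 + \<bar>x\<bar> powr q > 0" using \<mu> by (simp add: add_pos_nonneg)
    ultimately have "(s has_real_derivative inverse (s x) / 2 * (q * \<bar>x\<bar> powr q / x)) (at x)"
      unfolding s_def by (intro DERIV_chain2[OF DERIV_real_sqrt])
    from DERIV_mult[OF DERIV_ident this]
    have "(G has_real_derivative s x + inverse (s x) / 2 * (q * \<bar>x\<bar> powr q / x) * x) (at x)"
      by (simp add: G_def[abs_def])
    moreover have "s x + inverse (s x) / 2 * (q * \<bar>x\<bar> powr q / x) * x = ((s x)\<^sup>2 + q / 2 * \<bar>x\<bar> powr q) / s x"
      using False s_pos[of x] by (simp add: field_simps power2_eq_square)
    ultimately show ?thesis unfolding s2 q(2) by (simp add: G'_def algebra_simps)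
  qed
  obtain Gi where Gi: "\<And>y. G (Gi y) = y" "\<And>x. Gi (G x) = x"
    "\<And>y. (Gi has_real_derivative inverse (G' (Gi y))) (at y)"
    using DERIV_ge_imp_inverse[OF DG \<mu> G'_ge] by blast
  have "G (- x) = - G x" for x by (simp add: G_def s_def)
  then have Gi_odd: "Gi (- y) = - Gi y" for y by (metis Gi(1,2))
  have G'_even: "G' (- x) = G' x" for x by (simp add: G'_def s_def)
  \<comment> \<open>The angular speed as a function of \<open>A * sin \<phi>\<close>, the value of
    \<open>G f\<close>.\<close>
  define h where "h y = G' (Gi y)" for y
  have h_ge: "h y \<ge> \<mu>" for y by (simp add: h_def G'_ge)
  then have h_pos: "h y > 0" for y using \<mu> by (meson less_le_trans)
  have h_even: "h (- y) = h y" for y by (simp add: h_def Gi_odd G'_even)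
  have h_cont: "continuous_on UNIV h"
    unfolding h_def[abs_def]
    by (intro continuous_at_imp_continuous_on ballI isCont_o2[OF _ G'_cont] DERIV_isCont[OF Gi(3)])
  have "G 0 = 0" by (simp add: G_def)
  then have "Gi 0 = 0" using Gi(2)[of 0] by simp
  then have h0: "h 0 = \<mu>" using \<mu> by (simp add: h_def G'_def s_def power2_eq_square)
  have "strict_mono G"
    using DG less_le_trans[OF \<mu> G'_ge] by (rule strict_mono_if_DERIV_pos)
  then have Gi_le: "Z \<le> Gi y" if "G Z \<le> y" for Z y
    using that Gi(1)[of y] strict_mono_less_eq by metis
  then have "filterlim Gi at_top at_top"
    unfolding filterlim_at_top using eventually_ge_at_top by (metis (mono_tags, lifting) eventually_mono)
  \<comment> \<open>Decay of \<open>1 / h\<close>: for large \<open>y\<close>, \<open>h y\<close> is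
    at least \<open>s (Gi y)\<close>, which is at least \<open>Gi y powr (q / 2)\<close>.\<close>
  then have "((\<lambda>y. Gi y powr - (q / 2)) \<longlongrightarrow> 0) at_top"
    using q by (intro tendsto_neg_powr) auto
  moreover have "\<forall>\<^sub>F y in at_top. norm (1 / h y) \<le> Gi y powr - (q / 2)"
    using eventually_ge_at_top[of "G 1"]
  proof eventually_elim
    case (elim y)
    then have pos: "Gi y > 0" using Gi_le[of 1 y] by simp
    have "(Gi y powr (q / 2))\<^sup>2 \<le> (s (Gi y))\<^sup>2"
      unfolding s2 using pos by (simp add: power2_eq_square flip: powr_add)
    then have "Gi y powr (q / 2) \<le> s (Gi y)"
      using s_pos[of "Gi y"] by (auto intro: power2_le_imp_le less_imp_le)
    also have "\<dots> \<le> h y" by (simp add: h_def G'_ge_s)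
    finally have "1 / h y \<le> 1 / Gi y powr (q / 2)"
      using pos by (auto intro!: frac_le)
    then show ?case using h_pos[of y] by (simp add: powr_minus inverse_eq_divide)
  qed
  ultimately have lim: "((\<lambda>y. 1 / h y) \<longlongrightarrow> 0) at_top"
    by (rule Lim_null_comparison[rotated])
  obtain A :: real and n :: nat where A: "A > 0"
    and n: "n * integral {0..2 * pi} (\<lambda>x. 1 / h (A * sin x)) = 2 * pi"
    using exists_commensurable_period[OF h_cont \<mu> h_ge h_even lim h0] by blast
  define k where "k x = 1 / h (A * sin x)" for x
  have k_cont: "continuous_on UNIV k"
    unfolding k_def[abs_def] using h_pos
    by (intro continuous_intros continuous_on_compose2[OF h_cont]) (auto simp: less_imp_neq[THEN not_sym])
  \<comment> \<open>Only the compact range of \<open>A * sin\<close> matters, and the bound of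
    \<open>h\<close> on it keeps \<open>k\<close> away from 0.\<close>
  obtain M where M: "\<And>y. y \<in> {- A..A} \<Longrightarrow> h y \<le> M"
    using continuous_attains_sup[of "{- A..A}" h] A continuous_on_subset[OF h_cont] by force
  have "k x \<ge> 1 / M" for x
  proof -
    have "\<bar>A * sin x\<bar> \<le> A * 1" using A unfolding abs_mult by (intro mult_mono) auto
    then have "h (A * sin x) \<le> M" by (intro M) auto
    then show ?thesis using h_pos[of "A * sin x"] by (simp add: k_def frac_le)
  qed
  moreover have "M > 0" using M[of 0] h0 \<mu> A by simp
  ultimately obtain \<Phi> where \<Phi>: "\<And>t. (\<Phi> has_real_derivative inverse (k (\<Phi> t))) (at t)"
    "\<And>t. \<Phi> (- t) = - \<Phi> t" "\<And>t. \<Phi> (t + integral {0..2 * pi} k) = \<Phi> t + 2 * pi"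
    using angle_flow[OF k_cont, of "1 / M"] h_even by (auto simp: k_def)
  define T where "T = integral {0..2 * pi} k"
  have nT: "n * T = 2 * pi" using n by (simp add: T_def k_def[abs_def])
  \<comment> \<open>Time \<open>2 * pi\<close> consists of \<open>n\<close> basic periods, during
    which the angle makes \<open>n\<close> full turns.\<close>
  have "\<Phi> (t + real m * T) = \<Phi> t + 2 * pi * real m" for t m
  proof (induction m)
    case (Suc m)
    have "\<Phi> (t + real (Suc m) * T) = \<Phi> ((t + real m * T) + T)" by (simp add: algebra_simps)
    also have "\<dots> = \<Phi> (t + real m * T) + 2 * pi" unfolding T_def by (rule \<Phi>(3))
    finally show ?case using Suc by (simp add: algebra_simps)
  qed simp
  from this[of _ n] have \<Phi>_per: "\<Phi> (t + 2 * pi) = \<Phi> t + 2 * pi * real n" for t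
    unfolding nT .
  have sin_per: "sin (\<Phi> (t + 2 * pi)) = sin (\<Phi> t)" "cos (\<Phi> (t + 2 * pi)) = cos (\<Phi> t)" for t
    unfolding \<Phi>_per using sin_cos_eq_iff[of "\<Phi> t + 2 * pi * real n" "\<Phi> t"]
    by (metis of_int_of_nat_eq)+
  define f f' where "f t = Gi (A * sin (\<Phi> t))" and "f' t = A * cos (\<Phi> t)" for t
  have Gf: "G (f t) = A * sin (\<Phi> t)" for t by (simp add: f_def Gi)
  have D\<Phi>: "(\<Phi> has_real_derivative G' (f t)) (at t)" for t
    using \<Phi>(1)[of t] by (simp add: k_def h_def f_def)
  have G'f: "G' (f t) > 0" for t using G'_ge \<mu> by (meson less_le_trans)
  show thesis
  proof (rule that[OF A, of f f'])
    fix t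
    have d: "((\<lambda>t. A * sin (\<Phi> t)) has_real_derivative A * (cos (\<Phi> t) * G' (f t))) (at t)"
      by (auto intro!: derivative_eq_intros D\<Phi>)
    show "(f has_real_derivative f' t) (at t)"
      unfolding f_def[abs_def] f'_def
      by (rule DERIV_cong[OF DERIV_chain2[OF Gi(3) d]]) (use G'f[of t] in \<open>simp add: f_def\<close>)
    have "(f' has_real_derivative - (A * sin (\<Phi> t)) * G' (f t)) (at t)"
      unfolding f'_def[abs_def] by (auto intro!: derivative_eq_intros D\<Phi>)
    moreover have "G x * G' x = x * (\<mu>\<^sup>2 + (1 + 1 / \<mu>) * \<bar>x\<bar> powr q)" for x
      using s_pos[of x] by (simp add: G_def G'_def)
    ultimately show "(f' has_real_derivative - (f t * (\<mu>\<^sup>2 + (1 + 1 / \<mu>) * \<bar>f t\<bar> powr q))) (at t)"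
      by (simp flip: Gf)
    have "(f' t)\<^sup>2 + (G (f t))\<^sup>2 = A\<^sup>2 * ((cos (\<Phi> t))\<^sup>2 + (sin (\<Phi> t))\<^sup>2)"
      unfolding Gf f'_def by (simp only: power_mult_distrib distrib_left)
    then show "(f' t)\<^sup>2 + (f t)\<^sup>2 * (\<mu>\<^sup>2 + \<bar>f t\<bar> powr q) = A\<^sup>2"
      by (simp add: G_def power_mult_distrib s2)
  qed (simp_all add: f_def f'_def \<Phi>(2) Gi_odd sin_per)
qed

subsection \<open>Construction of solutions\<close>

lemma polar_form_circ:
  assumes "polar_form h s g"
  shows "polar_form h s (\<lambda>t. h (circ t))"
  using assms by (simp add: polar_form_def)
    (metis powr_one_eq_one scaleR_one zero_less_one)

theorem stationary_euler_solution_exists: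
  assumes \<alpha>: "\<alpha> > 1"
  shows "\<exists>u p \<rho>. rotational_homogeneous_symmetric_solution 2 punctured_plane \<alpha> u p \<rho>"
proof -
  define \<mu> where "\<mu> = \<alpha> - 1"
  \<comment> \<open>Vorticity has degree \<open>- \<mu> - 2\<close> and the stream function degree
    \<open>- \<mu>\<close>. A vorticity proportional to
    \<open>\<psi> * \<bar>\<psi>\<bar> powr q\<close> therefore requires
    \<open>\<mu> * q = 2\<close>.\<close>
  define q where "q = 2 / \<mu>"
  have \<mu>: "\<mu> > 0" using \<alpha> by (simp add: \<mu>_def)
  have q: "q > 0" using \<mu> by (simp add: q_def)
  obtain f f' :: "real \<Rightarrow> real" and A :: real where A: "A > 0"
    and f: "\<And>t. (f has_real_derivative f' t) (at t)"
    and f': "\<And>t. (f' has_real_derivative - (f t * (\<mu>\<^sup>2 + (1 + 1 / \<mu>) * \<bar>f t\<bar> powr q))) (at t)"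
    and energy: "\<And>t. (f' t)\<^sup>2 + (f t)\<^sup>2 * (\<mu>\<^sup>2 + \<bar>f t\<bar> powr q) = A\<^sup>2"
    and sym: "\<And>t. f (- t) = - f t" "\<And>t. f' (- t) = f' t"
    and per: "\<And>t. f (t + 2 * pi) = f t" "\<And>t. f' (t + 2 * pi) = f' t"
    by (rule periodic_oscillation_exists[OF \<mu>, folded q_def], rule that)
  \<comment> \<open>The polar components of the perpendicular gradient of the stream function
    \<open>r powr (- \<mu>) * f \<theta>\<close>.\<close>
  define a b where "a t = - f' t" and "b t = - \<mu> * f t" for t
  define a' where "a' t = \<mu>\<^sup>2 * f t + (1 + 1 / \<mu>) * (f t * \<bar>f t\<bar> powr q)" for t
  \<comment> \<open>The product \<open>f * \<bar>f\<bar> powr q\<close> is C^1 even across zeros of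
    \<open>f\<close>, which makes the velocity C^2.\<close>
  define a'' where "a'' t = \<mu>\<^sup>2 * f' t + (1 + 1 / \<mu>) * ((1 + q) * \<bar>f t\<bar> powr q * f' t)" for t
  have da: "(a has_real_derivative a' t) (at t)" for t
    using DERIV_minus[OF f'[of t]] by (simp add: a_def[abs_def] a'_def algebra_simps)
  have db: "(b has_real_derivative - \<mu> * f' t) (at t)" for t
    unfolding b_def[abs_def] by (auto intro!: derivative_eq_intros f)
  have da': "(a' has_real_derivative a'' t) (at t)" for t
    unfolding a'_def[abs_def] a''_def
    by (intro DERIV_add DERIV_cmult f DERIV_chain2[OF DERIV_mult_abs_powr[OF q] f])
  have cont: "continuous_on UNIV f" "continuous_on UNIV f'"
    by (meson f f' DERIV_isCont continuous_at_imp_continuous_on)+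
  have ca'': "continuous_on UNIV a''"
    unfolding a''_def[abs_def] using q by (intro continuous_intros cont continuous_on_powr') auto
  have circ_per: "circ (t + 2 * pi) = circ t" for t by (simp add: vec2_eq_iff)
  have perU: "a (t + 2 * pi) *\<^sub>R circ (t + 2 * pi) + b (t + 2 * pi) *\<^sub>R circ (t + 2 * pi + pi / 2)
      = a t *\<^sub>R circ t + b t *\<^sub>R circ (t + pi / 2)" for t
    using circ_per[of "t + pi / 2"] by (simp add: a_def b_def per circ_per add_ac)
  obtain u where u: "polar_form u (- \<alpha>) (\<lambda>t. a t *\<^sub>R circ t + b t *\<^sub>R circ (t + pi / 2))"
    using polar_form_exists[of "\<lambda>t. a t *\<^sub>R circ t + b t *\<^sub>R circ (t + pi / 2)"] perU by blast
  \<comment> \<open>Without density the profile of the pressure is constant; the radial equation at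
    a zero of \<open>f\<close> together with the energy identity fixes its value.\<close>
  obtain p where p: "polar_form p (- 2 * \<alpha>) (\<lambda>t. - A\<^sup>2 / 2)"
    using polar_form_exists[of "\<lambda>t. - A\<^sup>2 / 2"] by auto
  define \<rho> :: "real^2 \<Rightarrow> real" where "\<rho> = (\<lambda>x. 0)"
  have \<rho>: "polar_form \<rho> (- 2 * \<alpha> - 1) (\<lambda>t. 0)"
    by (simp add: polar_form_def \<rho>_def)
  have "stationary_boussinesq punctured_plane u p \<rho>"
  proof (subst polar_form_boussinesq_frame[OF u p \<rho> da db DERIV_const DERIV_const], intro allI conjI)
    fix t
    have a2: "(a t)\<^sup>2 = A\<^sup>2 - (f t)\<^sup>2 * (\<mu>\<^sup>2 + \<bar>f t\<bar> powr q)"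
      using energy[of t] by (simp add: a_def algebra_simps)
    have ba: "b t * a' t = - (f t)\<^sup>2 * (\<mu> ^ 3 + (\<mu> + 1) * \<bar>f t\<bar> powr q)"
      using \<mu> by (simp add: a'_def b_def field_simps power2_eq_square power3_eq_cube)
    have b2: "(b t)\<^sup>2 = \<mu>\<^sup>2 * (f t)\<^sup>2" by (simp add: b_def power_mult_distrib)
    have \<alpha>\<mu>: "\<alpha> = \<mu> + 1" by (simp add: \<mu>_def)
    show "b t * a' t - \<alpha> * (a t)\<^sup>2 - (b t)\<^sup>2 - 2 * \<alpha> * (- A\<^sup>2 / 2) = - 0 * sin t"
      unfolding a2 ba b2 \<alpha>\<mu> by (simp add: algebra_simps power2_eq_square power3_eq_cube)
    show "- \<mu> * f' t = (\<alpha> - 1) * a t" by (simp add: a_def \<mu>_def algebra_simps)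
  qed simp_all
  moreover have "neg_homogeneous \<alpha> u p \<rho>"
    unfolding neg_homogeneous_iff
    by (intro conjI polar_form_circ[OF u] polar_form_circ[OF p] polar_form_circ[OF \<rho>])
  moreover have "C_k_on 2 punctured_plane u"
  proof (rule polar_form_C2[OF u frame_has_vector_derivative[OF da db] frame_has_vector_derivative])
    show "((\<lambda>t. a' t - b t) has_real_derivative a'' t + \<mu> * f' t) (at t)" for t
      using DERIV_diff[OF da' db] by simp
    show "((\<lambda>t. a t + - \<mu> * f' t) has_real_derivative a' t + \<mu> * a' t) (at t)" for t
      using DERIV_add[OF da DERIV_cmult[OF da, of \<mu>]] by (simp add: a_def)
    have "continuous_on UNIV a" "continuous_on UNIV b" "continuous_on UNIV a'"
      by (meson da db da' DERIV_isCont continuous_at_imp_continuous_on)+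
    moreover have "continuous_on UNIV circ"
      by (meson circ_has_vector_derivative continuous_at_imp_continuous_on has_vector_derivative_continuous)
    ultimately show "continuous_on UNIV
     (\<lambda>t. (a'' t + \<mu> * f' t - (a t + - \<mu> * f' t)) *\<^sub>R circ t +
          (a' t - b t + (a' t + \<mu> * a' t)) *\<^sub>R circ (t + pi / 2))"
      by (intro continuous_intros ca'' cont continuous_on_compose2[of UNIV circ UNIV "\<lambda>t. t + pi / 2"]) auto
  qed
  moreover have "C_k_on 2 punctured_plane p" "C_k_on 2 punctured_plane \<rho>"
    using polar_form_C2[OF p has_vector_derivative_const has_vector_derivative_const]
      polar_form_C2[OF \<rho> has_vector_derivative_const has_vector_derivative_const] by simp_all
  moreover have "x2_symmetric punctured_plane u p \<rho>"
    unfolding x2_symmetric_def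
  proof (intro allI impI)
    fix x1 x2 :: real
    define x :: "real^2" where "x = vector [x1, x2]"
    assume "vector [x1, x2] \<in> punctured_plane"
    then have r: "norm x > 0" by (simp add: x_def)
    obtain t where t: "norm x *\<^sub>R circ t = x" using polar_decomposition by blast
    then have "x1 = norm x * cos t" "x2 = norm x * sin t"
      by (simp_all add: vec2_eq_iff x_def)
    then have "vector [x1, x2] = norm x *\<^sub>R circ t" "vector [x1, - x2] = norm x *\<^sub>R circ (- t)"
      by (simp_all add: vec2_eq_iff)
    then show "u (vector [x1, x2]) $ 1 = u (vector [x1, - x2]) $ 1
        \<and> u (vector [x1, x2]) $ 2 = - u (vector [x1, - x2]) $ 2
        \<and> p (vector [x1, x2]) = p (vector [x1, - x2])
        \<and> \<rho> (vector [x1, x2]) = - \<rho> (vector [x1, - x2])"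
      using polar_formD[OF u r] polar_formD[OF p r]
      by (simp only: frame_components vector_scaleR_component)
        (simp add: a_def b_def sym \<rho>_def algebra_simps)
  qed
  moreover have "rotational punctured_plane u"
  proof -
    have "\<exists>t. f t \<noteq> 0"
    proof (rule ccontr)
      assume "\<not> ?thesis"
      then have f0: "f = (\<lambda>t. 0)" by auto
      have "f' 0 = 0" using f[of 0] unfolding f0 by (rule DERIV_unique) (rule DERIV_const)
      then show False using energy[of 0] A f0 by simp
    qed
    then obtain t where "f t \<noteq> 0" by blast
    moreover have "(1 - \<alpha>) * b t - a' t = - ((1 + 1 / \<mu>) * (f t * \<bar>f t\<bar> powr q))"
      by (simp add: a'_def b_def \<mu>_def power2_eq_square algebra_simps)
    ultimately have "vorticity u (circ t) \<noteq> 0"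
      using polar_formD[OF polar_form_vorticity[OF u da db] zero_less_one, of t] \<mu>
      by (simp add: add_pos_pos less_imp_neq[THEN not_sym])
    then show ?thesis unfolding rotational_def by (intro bexI[of _ "circ t"]) auto
  qed
  ultimately show ?thesis
    unfolding rotational_homogeneous_symmetric_solution_def by blast
qed

text \<open>A horizontal velocity depending only on the height is not advected by itself, so zero
  pressure and density balance it. The profile is even, as the symmetry demands.\<close>

theorem shear_flow_solution:
  assumes \<alpha>: "\<alpha> < - 2"
  shows "rotational_homogeneous_symmetric_solution 1 UNIV \<alpha>
    (\<lambda>x. \<bar>x $ 2\<bar> powr (- \<alpha>) *\<^sub>R axis 1 1) (\<lambda>x. 0) (\<lambda>x. 0)"
proof -
  define u :: "real^2 \<Rightarrow> real^2" where "u = (\<lambda>x. \<bar>x $ 2\<bar> powr (- \<alpha>) *\<^sub>R axis 1 1)"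
  define d where "d y = - \<alpha> * (y * \<bar>y\<bar> powr (- \<alpha> - 2))" for y :: real
  have q: "- \<alpha> - 2 > 0" using \<alpha> by simp
  \<comment> \<open>Factoring out \<open>y\<close> twice leaves the positive exponent
    \<open>- \<alpha> - 2\<close>, so \<open>DERIV_mult_abs_powr\<close> yields the derivative also
    at 0.\<close>
  have powr_split: "\<bar>y\<bar> powr (- \<alpha>) = y * (y * \<bar>y\<bar> powr (- \<alpha> - 2))" for y :: real
    by (cases "y = 0") (use powr_diff[of "\<bar>y\<bar>" "- \<alpha>" 2] in \<open>simp_all add: power2_eq_square\<close>)
  have d: "((\<lambda>y. \<bar>y\<bar> powr (- \<alpha>)) has_real_derivative d y) (at y)" for y
    unfolding powr_split d_def
    by (rule DERIV_cong[OF DERIV_mult[OF DERIV_ident DERIV_mult_abs_powr[OF q]]])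
      (simp add: algebra_simps)
  have cd: "continuous_on UNIV d"
    unfolding d_def[abs_def] using q by (intro continuous_on_powr' continuous_intros) auto
  have D: "(u has_derivative (\<lambda>v. (d (x $ 2) * v $ 2) *\<^sub>R axis 1 1)) (at x)" for x
  proof -
    have "((\<lambda>x::real^2. x $ 2) has_derivative (\<lambda>v. v $ 2)) (at x)"
      by (rule bounded_linear_imp_has_derivative) (rule bounded_linear_vec_nth)
    from has_derivative_compose[OF this d[unfolded has_field_derivative_def]]
    have "((\<lambda>x. \<bar>x $ 2\<bar> powr (- \<alpha>)) has_derivative (\<lambda>v. d (x $ 2) * v $ 2)) (at x)" .
    from has_derivative_scaleR_left[OF this] show ?thesis unfolding u_def .
  qed
  have p1: "partial_derivative 1 u = (\<lambda>x. 0)" and p2: "partial_derivative 2 u = (\<lambda>x. d (x $ 2) *\<^sub>R axis 1 1)"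
    unfolding partial_derivative_def[abs_def] frechet_derivative_at[OF D, symmetric]
    by (simp_all add: axis_def)
  have p0: "partial_derivative i (\<lambda>x. 0 :: real) = (\<lambda>x. 0)" for i
    by (simp add: partial_derivative_def[abs_def])
  have "continuous_on UNIV (partial_derivative i u)" for i
  proof -
    have "continuous_on UNIV (\<lambda>x :: real^2. d (x $ 2) *\<^sub>R axis 1 1 :: real^2)"
      by (intro continuous_intros continuous_on_compose2[OF cd]) auto
    then show ?thesis using exhaust_2[of i] by (auto simp: p1 p2)
  qed
  then have "C_k_on 1 UNIV u" using D by (auto simp: differentiable_def)
  moreover have "C_k_on 1 UNIV (\<lambda>x :: real^2. 0 :: real)" by (simp add: p0)
  moreover have "stationary_boussinesq UNIV u (\<lambda>x. 0) (\<lambda>x. 0)"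
    by (simp add: stationary_boussinesq_def advection_def grad_def divergence_def sum_2 p1 p2 p0)
      (simp add: u_def axis_def vec2_eq_iff)
  moreover have "neg_homogeneous \<alpha> u (\<lambda>x. 0) (\<lambda>x. 0)"
    by (simp add: neg_homogeneous_def u_def abs_mult flip: powr_mult mult.assoc)
  moreover have "x2_symmetric UNIV u (\<lambda>x. 0) (\<lambda>x. 0)"
    by (simp add: x2_symmetric_def u_def axis_def)
  moreover have "rotational UNIV u"
    unfolding rotational_def vorticity_def p1 p2
    \<comment> \<open>At this point the vorticity equals \<open>\<alpha>\<close>.\<close>
    by (rule bexI[of _ "axis 2 1"]) (use \<alpha> in \<open>simp_all add: axis_def d_def\<close>)
  ultimately show ?thesis
    by (simp add: rotational_homogeneous_symmetric_solution_def u_def)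
qed

theorem theorem1p2:
  shows "(\<forall>\<alpha>::real. 0 \<le> \<alpha> \<and> \<alpha> \<le> 1 \<longrightarrow>
            \<not> (\<exists>u p \<rho>. rotational_homogeneous_symmetric_solution 1 punctured_plane \<alpha> u p \<rho>))
       \<and> (\<forall>\<alpha>::real. - 1 / 2 \<le> \<alpha> \<and> \<alpha> < 0 \<longrightarrow>
            \<not> (\<exists>u p \<rho>. rotational_homogeneous_symmetric_solution 2 punctured_plane \<alpha> u p \<rho>))
       \<and> (\<forall>\<alpha>::real. \<alpha> > 1 \<longrightarrow>
            (\<exists>u p \<rho>. rotational_homogeneous_symmetric_solution 2 punctured_plane \<alpha> u p \<rho>))
       \<and> (\<forall>\<alpha>::real. \<alpha> < - 2 \<longrightarrow>
            (\<exists>u p \<rho>. rotational_homogeneous_symmetric_solution 1 UNIV \<alpha> u p \<rho>))"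
proof (intro conjI allI impI)
  fix \<alpha> :: real
  assume "0 \<le> \<alpha> \<and> \<alpha> \<le> 1"
  then show "\<not> (\<exists>u p \<rho>. rotational_homogeneous_symmetric_solution 1 punctured_plane \<alpha> u p \<rho>)"
    using no_rotational_solution[of \<alpha> 1] by auto
next
  fix \<alpha> :: real
  assume "- 1 / 2 \<le> \<alpha> \<and> \<alpha> < 0"
  then show "\<not> (\<exists>u p \<rho>. rotational_homogeneous_symmetric_solution 2 punctured_plane \<alpha> u p \<rho>)"
    using no_rotational_solution[of \<alpha> 2] by auto
qed (use stationary_euler_solution_exists shear_flow_solution in blast)+

end
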